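(* Let $k\ge3$ and $\ell\ge2$ be integers, let $d>d_0(k)$ be an integer, and let $T^*$ be the $\ell$-linear degree $k$ discrete spherical maximal operator on $\mathbb{Z}^d$. Put $$r_0(d,k)=\frac{2+2\delta_0(d,k)}{(\ell-1)(2+2\delta_0(d,k))+(1+2\delta_0(d,k))}.$$ If $1<p_1,\dots,p_\ell\le\infty$ and $0<r\le\infty$ satisfy $$\frac1{p_1}+\cdots+\frac1{p_\ell}\ge\frac1r\qquad\text{and}\qquad r>\max\left\{r_0(d,k),\ \frac{d}{\ell d-k}\right\},$$ then $T^*$ is bounded $l^{p_1}(\mathbb{Z}^d)\times\cdots\times l^{p_\ell}(\mathbb{Z}^d)\to l^r(\mathbb{Z}^d)$, i.e. there is a constant $C$, independent of the functions, with $\|T^*(f_1,\dots,f_\ell)\|_{l^r(\mathbb{Z}^d)}\le C\prod_{i=1}^\ell\|f_i\|_{l^{p_i}(\mathbb{Z}^d)}$ for all $f_i\in l^{p_i}(\mathbb{Z}^d)$. Moreover, the bound $r>\frac{d}{\ell d-k}$ is a necessary condition: if $T^*$ is bounded $l^{p_1}(\mathbb{Z}^d)\times\cdots\times l^{p_\ell}(\mathbb{Z}^d)\to l^r(\mathbb{Z}^d)$ for some $1<p_1,\dots,p_\ell\le\infty$ and $0<r\le\infty$, then $r>\frac{d}{\ell d-k}$.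
   Context: For $u=(u^{(1)},\dots,u^{(d)})\in\mathbb{Z}^d$ write $|u|^k:=\sum_{j=1}^d|u^{(j)}|^k$ (a sum of $k$-th powers of absolute values of the coordinates). For integers $m\ge1$ and $\lambda\in\mathbb{N}=\{1,2,\dots\}$ let $N_m(\lambda)=\#\{(u_1,\dots,u_m)\in(\mathbb{Z}^d)^m:|u_1|^k+\cdots+|u_m|^k=\lambda\}$. For $f_1,\dots,f_m:\mathbb{Z}^d\to\mathbb{C}$ and $N_m(\lambda)>0$, the $m$-linear degree $k$ discrete spherical average is $$T_\lambda(f_1,\dots,f_m)(x)=\left|\frac1{N_m(\lambda)}\sum_{|u_1|^k+\cdots+|u_m|^k=\lambda}f_1(x-u_1)\cdots f_m(x-u_m)\right|,\qquad x\in\mathbb{Z}^d,$$ the sum being over $u_1,\dots,u_m\in\mathbb{Z}^d$. The $m$-linear maximal operator is $T^*(f_1,\dots,f_m)(x)=\sup_\lambda T_\lambda(f_1,\dots,f_m)(x)$, the supremum over $\lambda\in\mathbb{N}$ with $N_m(\lambda)>0$; for $m=1$ this is the discrete linear degree $k$ spherical maximal operator. The numbers $d_0(k)\ge k$ and $\delta_0(d,k)\ge0$ (for integers $d>d_0(k)$) are fixed real numbers for which the following known facts (from Anderson, Cook, Hughes and Kumchev, "Improved $l^p$ boundedness for integral $k$-spherical maximal functions") hold: (i) for every integer $m\ge1$ and every integer $d>d_0(k)/m$ there are constants $0<c\le C<\infty$ such that $c\,\lambda^{md/k-1}\le N_m(\lambda)\le C\,\lambda^{md/k-1}$ for all $\lambda\in\mathbb{N}$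 with $N_m(\lambda)>0$; (ii) for every integer $d>d_0(k)$ the discrete linear degree $k$ spherical maximal operator is bounded on $l^p(\mathbb{Z}^d)$ for all $p>p_0(d,k)$, where $$p_0(d,k)=\max\left\{1+\frac1{1+2\delta_0(d,k)},\ \frac d{d-k}\right\}.$$ Here $\|f\|_{l^p(\mathbb{Z}^d)}=\left(\sum_{x}|f(x)|^p\right)^{1/p}$ for $0<p<\infty$ (a quasi-norm when $p<1$), $\|f\|_{l^\infty(\mathbb{Z}^d)}=\sup_x|f(x)|$, and $1/\infty=0$. *)

theory Defs
  imports "HOL-Analysis.Analysis"
begin

text \<open>
  Since \<open>d\<close> is quantified over inside hypotheses, \<open>\<int>\<^sup>d\<close> is an explicit carrier: the integer sequences
  vanishing from index \<open>d\<close> on.  Coordinates and tuple entries are numbered from \<open>0\<close>.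
\<close>

definition Zd :: "nat \<Rightarrow> (nat \<Rightarrow> int) set" where
  "Zd d = {u. \<forall>j\<ge>d. u j = 0}"

definition kpow :: "nat \<Rightarrow> nat \<Rightarrow> (nat \<Rightarrow> int) \<Rightarrow> int" where
  "kpow d k u = (\<Sum>j<d. \<bar>u j\<bar> ^ k)"

definition sphere_tuples :: "nat \<Rightarrow> nat \<Rightarrow> nat \<Rightarrow> nat \<Rightarrow> (nat \<Rightarrow> nat \<Rightarrow> int) set" where
  "sphere_tuples d k m n = {u \<in> {..<m} \<rightarrow>\<^sub>E Zd d. (\<Sum>i<m. kpow d k (u i)) = int n}"

definition N_sphere :: "nat \<Rightarrow> nat \<Rightarrow> nat \<Rightarrow> nat \<Rightarrow> nat" where
  "N_sphere d k m n = card (sphere_tuples d k m n)"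

text \<open>
  Functions on \<open>\<int>\<^sup>d\<close> are total functions of which only the values on \<^term>\<open>Zd d\<close> are ever used.
\<close>

definition T_avg ::
  "nat \<Rightarrow> nat \<Rightarrow> nat \<Rightarrow> nat \<Rightarrow> (nat \<Rightarrow> (nat \<Rightarrow> int) \<Rightarrow> complex) \<Rightarrow> (nat \<Rightarrow> int) \<Rightarrow> real" where
  "T_avg d k m n f x =
     cmod (1 / of_nat (N_sphere d k m n) *
       (\<Sum>u\<in>sphere_tuples d k m n. \<Prod>i<m. f i (\<lambda>j. x j - u i j)))"

text \<open>The supremum is taken in \<open>[0,\<infinity>]\<close>, so that it exists for arbitrary functions.\<close>

definition T_max ::
  "nat \<Rightarrow> nat \<Rightarrow> nat \<Rightarrow> (nat \<Rightarrow> (nat \<Rightarrow> int) \<Rightarrow> complex) \<Rightarrow> (nat \<Rightarrow> int) \<Rightarrow> ennreal" where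
  "T_max d k m f x =
     (SUP n\<in>{n. n \<ge> 1 \<and> N_sphere d k m n > 0}. ennreal (T_avg d k m n f x))"

text \<open>Real powers on \<open>[0,\<infinity>]\<close>; only used with exponent \<open>a > 0\<close>.\<close>

definition epowr :: "ennreal \<Rightarrow> real \<Rightarrow> ennreal" where
  "epowr t a = (if t = top then top else ennreal (enn2real t powr a))"

text \<open>
  The (quasi-)norm of a \<open>[0,\<infinity>]\<close>-valued function on \<open>A\<close>, for \<open>0 < p \<le> \<infinity>\<close>.
  It is \<open>\<infinity>\<close> when the function is not in \<open>l\<^sup>p(A)\<close>.
\<close>

definition lp_norm :: "ereal \<Rightarrow> 'a set \<Rightarrow> ('a \<Rightarrow> ennreal) \<Rightarrow> ennreal" where
  "lp_norm p A g =
     (if p = \<infinity> then (SUP x\<in>A. g x)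
      else epowr (\<integral>\<^sup>+ x. epowr (g x) (real_of_ereal p) \<partial>count_space A) (1 / real_of_ereal p))"

definition lp_cnorm :: "ereal \<Rightarrow> 'a set \<Rightarrow> ('a \<Rightarrow> complex) \<Rightarrow> ennreal" where
  "lp_cnorm p A f = lp_norm p A (\<lambda>x. ennreal (cmod (f x)))"

definition lp_space :: "ereal \<Rightarrow> 'a set \<Rightarrow> ('a \<Rightarrow> complex) set" where
  "lp_space p A = {f. lp_cnorm p A f < top}"

definition T_max_bounded :: "nat \<Rightarrow> nat \<Rightarrow> nat \<Rightarrow> (nat \<Rightarrow> ereal) \<Rightarrow> ereal \<Rightarrow> bool" where
  "T_max_bounded d k m p r \<longleftrightarrow>
     (\<exists>C::real. \<forall>f. (\<forall>i<m. f i \<in> lp_space (p i) (Zd d)) \<longrightarrow>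
        lp_norm r (Zd d) (T_max d k m f) \<le> ennreal C * (\<Prod>i<m. lp_cnorm (p i) (Zd d) (f i)))"

definition p0 :: "(nat \<Rightarrow> nat \<Rightarrow> real) \<Rightarrow> nat \<Rightarrow> nat \<Rightarrow> real" where
  "p0 \<delta>0 d k = max (1 + 1 / (1 + 2 * \<delta>0 d k)) (real d / (real d - real k))"

definition r0 :: "(nat \<Rightarrow> nat \<Rightarrow> real) \<Rightarrow> nat \<Rightarrow> nat \<Rightarrow> nat \<Rightarrow> real" where
  "r0 \<delta>0 l d k =
     (2 + 2 * \<delta>0 d k) / ((real l - 1) * (2 + 2 * \<delta>0 d k) + (1 + 2 * \<delta>0 d k))"

end

theory Submission
  imports Defs
begin

text \<open>
  Sufficiency.  Besides the linear bound, positivity of the kernel and counting suffice.  In a tuple on the sphere of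
  radius \<open>n\<close> single out one entry \<open>u j\<close>.  The other \<open>l - 1\<close> entries lie in the ball of radius \<open>n\<close>, and
  once they are fixed \<open>u j\<close> runs over a linear sphere.  The asymptotics for the number of points on
  both spheres then bound the \<open>l\<close>-linear maximal function pointwise by the product of the linear
  spherical maximal function of \<open>f j\<close> and the Hardy--Littlewood maximal functions of the other
  arguments (\<open>avg_max_le_prod\<close>).  The discrete Hardy--Littlewood operator is bounded for all exponents
  above \<open>1\<close> (\<open>HL_max_bounded\<close>: a covering argument and Marcinkiewicz interpolation), so Hoelder's
  inequality gives the bound when \<open>1 / r\<close> is the sum of the \<open>1 / p i\<close>, all \<open>p i > 1\<close>, and at least one
  \<open>p j\<close> exceeds the critical exponent \<open>p0\<close> of the linear operator.

  Put \<open>\<beta> = 1 / p0\<close>.  The hypothesis on \<open>r\<close> says that \<open>1 / r < l - 1 + \<beta>\<close>, which still allows all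
  \<open>1 / p i\<close> to be at least \<open>\<beta>\<close>.  Such a point is a convex combination of points covered so far
  (\<open>convex_combination_of_admissible\<close>), and one can interpolate: splitting each nonnegative argument
  into powers of itself and applying Hoelder's inequality to the average shows that the maximal
  function is at most a weighted geometric mean of maximal functions of powers
  (\<open>avg_max_le_geometric_mean\<close>).  Linearization of the supremum and complex interpolation, which
  would be delicate for \<open>r < 1\<close>, are thereby avoided.  Finally, if \<open>1 / r\<close> is smaller than the sum of the
  \<open>1 / p i\<close>, the exponents \<open>p i\<close> can be increased because the \<open>l\<^sup>p\<close> spaces are nested.

  Necessity.  For point masses at the origin the maximal function at \<open>x\<close> is at least the reciprocal
  of the number of tuples on the sphere through \<open>(x, ..., x)\<close>, hence decays no faster than
  \<open>|x|\<close> to the power \<open>k - l * d\<close> (here \<open>|x|\<close> is the size of the largest coordinate).  Its \<open>r\<close>-th power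
  is summable over the \<open>d\<close>-dimensional lattice only if \<open>r * (l * d - k) > d\<close>.
\<close>

section \<open>Real powers of extended nonnegative numbers\<close>

lemma epowr_ennreal: "x \<ge> 0 \<Longrightarrow> epowr (ennreal x) a = ennreal (x powr a)"
  by (simp add: epowr_def)

lemma epowr_top [simp]: "epowr top a = top"
  by (simp add: epowr_def)

lemma epowr_zero [simp]: "epowr 0 a = 0"
  by (simp add: epowr_def)

lemma epowr_one [simp]: "epowr t 1 = t"
  by (cases t) (auto simp: epowr_ennreal)

lemma epowr_eq_0_iff [simp]: "epowr t a = 0 \<longleftrightarrow> t = 0"
  by (cases t) (auto simp: epowr_ennreal ennreal_eq_0_iff)

lemma epowr_eq_top_iff [simp]: "epowr t a = top \<longleftrightarrow> t = top"
  by (simp add: epowr_def)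

lemma epowr_mono: "a \<ge> 0 \<Longrightarrow> s \<le> t \<Longrightarrow> epowr s a \<le> epowr t a"
  by (cases s; cases t) (auto simp: epowr_ennreal top_unique intro!: ennreal_leI powr_mono2)

lemma epowr_mult: "epowr (s * t) a = epowr s a * epowr t a"
proof (cases "s = 0 \<or> t = 0 \<or> s = top \<or> t = top")
  case True
  then show ?thesis by (auto simp: ennreal_mult_top ennreal_top_mult)
next
  case False
  then show ?thesis
    by (cases s; cases t)
      (auto simp: epowr_ennreal powr_mult simp flip: ennreal_mult)
qed

lemma epowr_prod: "finite I \<Longrightarrow> epowr (\<Prod>i\<in>I. f i) a = (\<Prod>i\<in>I. epowr (f i) a)"
proof (induction I rule: finite_induct)
  case empty
  have "epowr (ennreal 1) a = 1" by (subst epowr_ennreal) auto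
  then show ?case by simp
qed (simp add: epowr_mult)

lemma epowr_epowr: "epowr (epowr t a) b = epowr t (a * b)"
  by (cases t) (auto simp: epowr_ennreal powr_powr)

lemma epowr_add: "epowr t (a + b) = epowr t a * epowr t b"
  by (cases t) (auto simp: epowr_ennreal powr_add ennreal_mult)

lemma epowr_sum:
  "finite I \<Longrightarrow> I \<noteq> {} \<Longrightarrow> epowr t (\<Sum>i\<in>I. a i) = (\<Prod>i\<in>I. epowr t (a i))"
  by (induction I rule: finite_ne_induct) (simp_all add: epowr_add)

lemma epowr_max: "a \<ge> 0 \<Longrightarrow> epowr (max s t) a = max (epowr s a) (epowr t a)"
  using epowr_mono[of a s t] epowr_mono[of a t s] by (auto simp: max_def)

section \<open>Hoelder's inequality for several functions\<close>

text \<open>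
  Convexity of the exponential function, applied to the logarithms.
\<close>

lemma weighted_arith_geom_mean:
  fixes w x :: "'a \<Rightarrow> real"
  assumes fin: "finite I" and ne: "I \<noteq> {}" and w: "\<And>i. i \<in> I \<Longrightarrow> w i > 0"
    and w1: "(\<Sum>i\<in>I. w i) = 1" and x: "\<And>i. i \<in> I \<Longrightarrow> x i \<ge> 0"
  shows "(\<Prod>i\<in>I. x i powr w i) \<le> (\<Sum>i\<in>I. w i * x i)"
proof (cases "\<exists>i\<in>I. x i = 0")
  case True
  then have "(\<Prod>i\<in>I. x i powr w i) = 0" using fin by auto
  also have "0 \<le> (\<Sum>i\<in>I. w i * x i)" using w x by (intro sum_nonneg) (simp add: less_imp_le)
  finally show ?thesis .
next
  case False
  then have pos: "x i > 0" if "i \<in> I" for i using x[OF that] that by (auto simp: less_le)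
  have "(\<Prod>i\<in>I. x i powr w i) = exp (\<Sum>i\<in>I. w i *\<^sub>R ln (x i))"
    using fin pos by (simp add: exp_sum powr_def less_imp_neq[THEN not_sym] cong: prod.cong)
  also have "\<dots> \<le> (\<Sum>i\<in>I. w i * exp (ln (x i)))"
    using w w1 by (intro convex_on_sum[OF fin ne exp_convex]) (auto simp: less_imp_le)
  also have "\<dots> = (\<Sum>i\<in>I. w i * x i)" using pos by (intro sum.cong) auto
  finally show ?thesis .
qed

lemma weighted_arith_geom_mean_ennreal:
  fixes w :: "'a \<Rightarrow> real" and x :: "'a \<Rightarrow> ennreal"
  assumes fin: "finite I" and ne: "I \<noteq> {}" and w: "\<And>i. i \<in> I \<Longrightarrow> w i > 0"
    and w1: "(\<Sum>i\<in>I. w i) = 1"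
  shows "(\<Prod>i\<in>I. epowr (x i) (w i)) \<le> (\<Sum>i\<in>I. ennreal (w i) * x i)"
proof (cases "\<exists>i\<in>I. x i = top")
  case True
  then obtain i where i: "i \<in> I" "x i = top" by auto
  then have "ennreal (w i) * x i = top" using w[of i] by (simp add: ennreal_mult_top ennreal_eq_0_iff)
  then have "(\<Sum>i\<in>I. ennreal (w i) * x i) = top" using i fin by (simp add: sum.remove)
  then show ?thesis by simp
next
  case False
  define y where "y i = enn2real (x i)" for i
  have x: "i \<in> I \<Longrightarrow> x i = ennreal (y i)" for i
    using False by (auto simp: y_def ennreal_enn2real_if)
  have y: "y i \<ge> 0" for i by (simp add: y_def)
  have "(\<Prod>i\<in>I. epowr (x i) (w i)) = ennreal (\<Prod>i\<in>I. y i powr w i)"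
    using y by (simp add: prod_ennreal[symmetric] x epowr_ennreal cong: prod.cong)
  also have "\<dots> \<le> ennreal (\<Sum>i\<in>I. w i * y i)"
    using assms y by (intro ennreal_leI weighted_arith_geom_mean) auto
  also have "\<dots> = (\<Sum>i\<in>I. ennreal (w i) * x i)"
    using w y by (simp add: sum_ennreal[symmetric] x ennreal_mult less_imp_le cong: sum.cong)
  finally show ?thesis .
qed

text \<open>
  After dividing each factor by its integral, the pointwise inequality between the weighted geometric
  and arithmetic means can be integrated; the right-hand side then integrates to the sum of the
  weights.  If some integral vanishes, so does that factor everywhere, and if some integral is
  infinite while none vanishes, the bound is trivial.
\<close>

lemma nn_integral_Holder:
  fixes w :: "'i \<Rightarrow> real" and F :: "'i \<Rightarrow> 'a \<Rightarrow> ennreal"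
  assumes fin: "finite I" and ne: "I \<noteq> {}" and w: "\<And>i. i \<in> I \<Longrightarrow> w i > 0"
    and w1: "(\<Sum>i\<in>I. w i) = 1"
  shows "(\<integral>\<^sup>+x. (\<Prod>i\<in>I. epowr (F i x) (w i)) \<partial>count_space A)
    \<le> (\<Prod>i\<in>I. epowr (\<integral>\<^sup>+x. F i x \<partial>count_space A) (w i))" (is "?L \<le> ?R")
proof -
  define N where "N i = (\<integral>\<^sup>+x. F i x \<partial>count_space A)" for i
  consider (zero) i where "i \<in> I" "N i = 0" | (top) i where "i \<in> I" "N i = top" "\<forall>i\<in>I. N i \<noteq> 0"
    | (pos) "\<forall>i\<in>I. N i \<noteq> 0 \<and> N i \<noteq> top" by blast
  then show ?thesis
  proof cases
    case zero
    have "F i x = 0" if "x \<in> A" for x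
      using nn_integral_ge_point[OF that, of "F i"] zero by (simp add: N_def)
    then have "?L = (\<integral>\<^sup>+x. 0 \<partial>count_space A)"
      using zero(1) fin by (intro nn_integral_cong) auto
    then show ?thesis by simp
  next
    case top
    then have "?R = top"
      using fin by (subst ennreal_prod_eq_top) (auto simp flip: N_def)
    then show ?thesis by simp
  next
    case pos
    define c where "c i = 1 / N i" for i
    have c: "c i * N i = 1" if "i \<in> I" for i
      using pos that by (simp add: c_def ennreal_divide_times ennreal_divide_self less_top)
    define P where "P = (\<Prod>i\<in>I. epowr (N i) (w i))"
    have "P * (\<Prod>i\<in>I. epowr (c i) (w i)) = (\<Prod>i\<in>I. epowr (c i * N i) (w i))"
      by (simp add: P_def epowr_mult prod.distrib mult.commute)
    also have "\<dots> = 1"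
      using epowr_ennreal[of 1] by (intro prod.neutral) (simp add: c)
    finally have P: "P * (\<Prod>i\<in>I. epowr (c i) (w i)) = 1" .
    have "?L = P * (\<Prod>i\<in>I. epowr (c i) (w i)) * ?L" by (simp add: P)
    also have "\<dots> = P * (\<integral>\<^sup>+x. (\<Prod>i\<in>I. epowr (c i * F i x) (w i)) \<partial>count_space A)"
      by (simp add: epowr_mult prod.distrib nn_integral_cmult mult.assoc)
    also have "\<dots> \<le> P * (\<integral>\<^sup>+x. (\<Sum>i\<in>I. ennreal (w i) * (c i * F i x)) \<partial>count_space A)"
      using assms by (intro mult_left_mono nn_integral_mono weighted_arith_geom_mean_ennreal) auto
    also have "(\<integral>\<^sup>+x. (\<Sum>i\<in>I. ennreal (w i) * (c i * F i x)) \<partial>count_space A)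
        = (\<Sum>i\<in>I. ennreal (w i) * (c i * N i))"
      by (simp add: nn_integral_sum nn_integral_cmult N_def)
    also have "\<dots> = (\<Sum>i\<in>I. ennreal (w i))" by (intro sum.cong) (auto simp: c)
    also have "\<dots> = 1" using w w1 by (subst sum_ennreal) (auto simp: less_imp_le)
    finally show ?thesis by (simp add: P_def N_def)
  qed
qed

corollary sum_Holder:
  fixes w :: "'i \<Rightarrow> real" and F :: "'i \<Rightarrow> 'a \<Rightarrow> ennreal"
  assumes "finite I" "I \<noteq> {}" "\<And>i. i \<in> I \<Longrightarrow> w i > 0" "(\<Sum>i\<in>I. w i) = 1" "finite A"
  shows "(\<Sum>x\<in>A. \<Prod>i\<in>I. epowr (F i x) (w i)) \<le> (\<Prod>i\<in>I. epowr (\<Sum>x\<in>A. F i x) (w i))"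
  using nn_integral_Holder[OF assms(1-4), where F = F and A = A] assms(5) by (simp add: nn_integral_count_space_finite)

section \<open>Norms indexed by the reciprocal exponent\<close>

text \<open>
  The \<open>l\<^sup>p\<close> (quasi-)norm as a function of \<open>c = 1 / p\<close>.  In this parameter Hoelder's inequality adds
  exponents, interpolation takes convex combinations of them, and \<open>p = \<infinity>\<close> is the ordinary value
  \<open>c = 0\<close>.
\<close>

definition recip_norm :: "real \<Rightarrow> 'a set \<Rightarrow> ('a \<Rightarrow> ennreal) \<Rightarrow> ennreal" where
  "recip_norm c A g =
    (if c = 0 then (SUP x\<in>A. g x) else epowr (\<integral>\<^sup>+x. epowr (g x) (1 / c) \<partial>count_space A) c)"

lemma lp_norm_eq_recip_norm:
  assumes "p > 0"
  shows "lp_norm p A g = recip_norm (real_of_ereal (1 / p)) A g"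
  using assms by (cases p) (auto simp: lp_norm_def recip_norm_def one_ereal_def)

lemma recip_norm_mono:
  assumes "c \<ge> 0" "\<And>x. x \<in> A \<Longrightarrow> g x \<le> h x"
  shows "recip_norm c A g \<le> recip_norm c A h"
  using assms
  by (auto simp: recip_norm_def intro!: SUP_mono epowr_mono nn_integral_mono)

lemma recip_norm_cong:
  assumes "\<And>x. x \<in> A \<Longrightarrow> g x = h x"
  shows "recip_norm c A g = recip_norm c A h"
  using assms
  by (auto simp: recip_norm_def intro!: SUP_cong arg_cong2[where f = epowr] nn_integral_cong)

lemma recip_norm_cmult: 
  assumes "c \<ge> 0"
  shows "recip_norm c A (\<lambda>x. K * g x) = K * recip_norm c A g"
proof (cases "c = 0")
  case True
  then show ?thesis by (simp add: recip_norm_def SUP_mult_left_ennreal)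
next
  case False
  then show ?thesis using assms
    by (simp add: recip_norm_def epowr_mult nn_integral_cmult epowr_epowr)
qed

lemma le_recip_norm:
  assumes "c \<ge> 0" "x \<in> A"
  shows "g x \<le> recip_norm c A g"
proof (cases "c = 0")
  case True
  then show ?thesis using assms by (simp add: recip_norm_def SUP_upper)
next
  case False
  have "g x = epowr (epowr (g x) (1 / c)) c" using False by (simp add: epowr_epowr)
  also have "\<dots> \<le> recip_norm c A g"
    using False assms nn_integral_ge_point[OF assms(2), of "\<lambda>x. epowr (g x) (1 / c)"]
    by (simp add: recip_norm_def epowr_mono)
  finally show ?thesis .
qed

text \<open>
  On a counting measure every value of \<open>g\<close> is at most its norm \<open>N\<close>, so the surplus power of \<open>g\<close>
  needed for the larger exponent \<open>1 / b\<close> can be replaced by the same power of \<open>N\<close>.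
\<close>

lemma recip_norm_nested:
  assumes "0 \<le> b" "b \<le> a"
  shows "recip_norm b A g \<le> recip_norm a A g"
proof (cases "b = 0 \<or> a = b")
  case True
  then show ?thesis
    using assms le_recip_norm[of a _ A g] by (auto simp: recip_norm_def[of 0] intro!: SUP_least)
next
  case False
  with assms have pos: "0 < b" "b < a" by auto
  define N where "N = recip_norm a A g"
  have int: "(\<integral>\<^sup>+x. epowr (g x) (1 / a) \<partial>count_space A) = epowr N (1 / a)"
    using pos by (simp add: N_def recip_norm_def epowr_epowr)
  have e: "1 / b = 1 / a + (1 / b - 1 / a)" "1 / b - 1 / a \<ge> 0"
    using pos by (auto simp: field_simps)
  have "(\<integral>\<^sup>+x. epowr (g x) (1 / b) \<partial>count_space A)
      = (\<integral>\<^sup>+x. epowr (g x) (1 / a) * epowr (g x) (1 / b - 1 / a) \<partial>count_space A)"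
    by (subst e(1), subst epowr_add) simp
  also have "\<dots> \<le> (\<integral>\<^sup>+x. epowr (g x) (1 / a) * epowr N (1 / b - 1 / a) \<partial>count_space A)"
    using pos e(2) le_recip_norm[of a _ A g]
    by (intro nn_integral_mono mult_left_mono epowr_mono) (auto simp: N_def)
  also have "\<dots> = epowr N (1 / b)"
    by (subst nn_integral_multc) (simp_all add: int flip: epowr_add)
  finally have "recip_norm b A g \<le> epowr (epowr N (1 / b)) b"
    using pos by (simp add: recip_norm_def epowr_mono)
  then show ?thesis using pos by (simp add: epowr_epowr N_def)
qed

lemma recip_norm_epowr:
  assumes "s > 0" "c > 0"
  shows "recip_norm (s * c) A (\<lambda>x. epowr (g x) s) = epowr (recip_norm c A g) s"
  using assms by (simp add: recip_norm_def epowr_epowr mult.commute)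

lemma recip_norm_max_le:
  assumes "c \<ge> 0"
  shows "recip_norm c A (\<lambda>x. max (g x) (h x))
    \<le> ennreal (2 powr c) * max (recip_norm c A g) (recip_norm c A h)"
proof (cases "c = 0")
  case True
  then show ?thesis
    by (auto simp: recip_norm_def intro!: SUP_least max.mono SUP_upper)
next
  case False
  with assms have c: "c > 0" by simp
  define G where "G = (\<integral>\<^sup>+x. epowr (g x) (1 / c) \<partial>count_space A)"
  define H where "H = (\<integral>\<^sup>+x. epowr (h x) (1 / c) \<partial>count_space A)"
  have "(\<integral>\<^sup>+x. epowr (max (g x) (h x)) (1 / c) \<partial>count_space A)
      \<le> (\<integral>\<^sup>+x. epowr (g x) (1 / c) + epowr (h x) (1 / c) \<partial>count_space A)"
    using c by (intro nn_integral_mono) (simp add: epowr_max)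
  also have "\<dots> = G + H" by (simp add: nn_integral_add G_def H_def)
  also have "\<dots> \<le> max G H + max G H" by (intro add_mono) auto
  also have "\<dots> = ennreal 2 * max G H" by (simp add: mult_2)
  finally have "recip_norm c A (\<lambda>x. max (g x) (h x)) \<le> epowr (ennreal 2 * max G H) c"
    using c by (simp add: recip_norm_def epowr_mono)
  also have "\<dots> = ennreal (2 powr c) * max (recip_norm c A g) (recip_norm c A h)"
    using c epowr_ennreal[of 2 c]
    by (simp add: epowr_mult epowr_max recip_norm_def G_def H_def)
  finally show ?thesis .
qed

text \<open>
  Factors measured in \<open>l\<^sup>\<infinity>\<close> are bounded by constants and pulled out of the norm; the remaining ones
  satisfy the integral form of the inequality with weights \<open>c i / \<rho>\<close>, where \<open>\<rho>\<close> is the sum of all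
  \<open>c i\<close>.  That form is applied to the power \<open>1 / \<rho>\<close> of the product, so the target may be a quasi-norm
  (\<open>\<rho> > 1\<close>).
\<close>

theorem recip_norm_Holder:
  fixes c :: "'i \<Rightarrow> real"
  assumes fin: "finite I" and c: "\<And>i. i \<in> I \<Longrightarrow> c i \<ge> 0"
  shows "recip_norm (\<Sum>i\<in>I. c i) A (\<lambda>x. \<Prod>i\<in>I. G i x) \<le> (\<Prod>i\<in>I. recip_norm (c i) A (G i))"
proof (cases "(\<Sum>i\<in>I. c i) = 0")
  case True
  then have "\<forall>i\<in>I. c i = 0" using sum_nonneg_eq_0_iff[of I c] fin c by auto
  then show ?thesis
    using True unfolding recip_norm_def[of "sum c I"]
    by (auto intro!: SUP_least prod_mono_ennreal le_recip_norm)
next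
  case False
  define \<rho> where "\<rho> = (\<Sum>i\<in>I. c i)"
  have \<rho>: "\<rho> > 0" using False c sum_nonneg[of I c] by (auto simp: \<rho>_def less_le)
  define J where "J = {i\<in>I. c i > 0}"
  have J: "finite J" "J \<subseteq> I" using fin by (auto simp: J_def)
  have sumJ: "(\<Sum>i\<in>J. c i) = \<rho>"
    unfolding \<rho>_def using fin c by (intro sum.mono_neutral_left) (auto simp: J_def less_le)
  then have neJ: "J \<noteq> {}" using \<rho> by auto
  have split: "prod f I = prod f (I - J) * prod f J" for f :: "'i \<Rightarrow> ennreal"
    using J fin by (metis prod.subset_diff)
  define K where "K = (\<Prod>i\<in>I - J. recip_norm (c i) A (G i))"
  have "recip_norm \<rho> A (\<lambda>x. \<Prod>i\<in>I. G i x) \<le> recip_norm \<rho> A (\<lambda>x. K * (\<Prod>i\<in>J. G i x))"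
    unfolding K_def split using c \<rho>
    by (intro recip_norm_mono mult_right_mono prod_mono_ennreal le_recip_norm) auto
  also have "\<dots> = K * recip_norm \<rho> A (\<lambda>x. \<Prod>i\<in>J. G i x)"
    using \<rho> by (intro recip_norm_cmult) auto
  also have "recip_norm \<rho> A (\<lambda>x. \<Prod>i\<in>J. G i x)
      = epowr (\<integral>\<^sup>+x. (\<Prod>i\<in>J. epowr (epowr (G i x) (1 / c i)) (c i / \<rho>)) \<partial>count_space A) \<rho>"
    using \<rho> J by (auto simp: recip_norm_def epowr_prod epowr_epowr J_def
        intro!: arg_cong2[where f = epowr] nn_integral_cong prod.cong)
  also have "\<dots> \<le> epowr (\<Prod>i\<in>J. epowr (\<integral>\<^sup>+x. epowr (G i x) (1 / c i) \<partial>count_space A) (c i / \<rho>)) \<rho>"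
    using \<rho> J neJ sumJ
    by (intro epowr_mono nn_integral_Holder) (auto simp: J_def simp flip: sum_divide_distrib)
  also have "\<dots> = (\<Prod>i\<in>J. recip_norm (c i) A (G i))"
    using \<rho> J by (auto simp: epowr_prod epowr_epowr recip_norm_def J_def intro!: prod.cong)
  finally show ?thesis
    by (simp add: split K_def mult_left_mono flip: \<rho>_def)
qed

section \<open>The discrete Hardy--Littlewood maximal function\<close>

definition int_box :: "nat \<Rightarrow> nat \<Rightarrow> (nat \<Rightarrow> int) set" where
  "int_box d R = {u \<in> Zd d. \<forall>j<d. \<bar>u j\<bar> \<le> int R}"

definition int_cube :: "nat \<Rightarrow> (nat \<Rightarrow> int) \<Rightarrow> nat \<Rightarrow> (nat \<Rightarrow> int) set" where
  "int_cube d x R = {y \<in> Zd d. \<forall>j<d. \<bar>x j - y j\<bar> \<le> int R}"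

text \<open>
  Averages over cubes rather than over the balls \<open>kpow d k u \<le> n\<close>: the cardinality of a cube is
  explicit, and a ball lies in a cube of comparable cardinality.
\<close>

definition HL_max :: "nat \<Rightarrow> ((nat \<Rightarrow> int) \<Rightarrow> ennreal) \<Rightarrow> (nat \<Rightarrow> int) \<Rightarrow> ennreal" where
  "HL_max d g x = (SUP R. (\<Sum>u\<in>int_box d R. g (\<lambda>j. x j - u j)) / ennreal ((2 * real R + 1) ^ d))"

lemma bij_betw_Zd_PiE:
  "bij_betw (\<lambda>u. restrict u {..<d}) {u \<in> Zd d. \<forall>j<d. u j \<in> A} ({..<d} \<rightarrow>\<^sub>E A)"
proof (rule bij_betw_byWitness[where f' = "\<lambda>v j. if j < d then v j else 0"])
  show "\<forall>u\<in>{u \<in> Zd d. \<forall>j<d. u j \<in> A}. (\<lambda>j. if j < d then restrict u {..<d} j else 0) = u"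
    by (auto simp: Zd_def fun_eq_iff)
  show "\<forall>v\<in>{..<d} \<rightarrow>\<^sub>E A. restrict (\<lambda>j. if j < d then v j else 0) {..<d} = v"
    by (auto simp: fun_eq_iff PiE_def extensional_def restrict_def)
  show "(\<lambda>u. restrict u {..<d}) ` {u \<in> Zd d. \<forall>j<d. u j \<in> A} \<subseteq> {..<d} \<rightarrow>\<^sub>E A"
    by (intro image_subsetI) (simp add: restrict_PiE_iff)
  show "(\<lambda>v j. if j < d then v j else 0) ` ({..<d} \<rightarrow>\<^sub>E A) \<subseteq> {u \<in> Zd d. \<forall>j<d. u j \<in> A}"
    by (auto simp: Zd_def PiE_def Pi_def)
qed

lemma finite_Zd_coords: "finite A \<Longrightarrow> finite {u \<in> Zd d. \<forall>j<d. u j \<in> A}"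
  using bij_betw_finite[OF bij_betw_Zd_PiE[of d A]] by (simp add: finite_PiE)

lemma card_Zd_coords: "card {u \<in> Zd d. \<forall>j<d. u j \<in> A} = card A ^ d"
  using bij_betw_same_card[OF bij_betw_Zd_PiE[of d A]] by (simp add: card_PiE)

lemma int_box_eq: "int_box d R = {u \<in> Zd d. \<forall>j<d. u j \<in> {- int R..int R}}"
  by (auto simp: int_box_def abs_le_iff)

lemma finite_box [simp]: "finite (int_box d R)"
  unfolding int_box_eq by (rule finite_Zd_coords) simp

lemma card_box: "card (int_box d R) = (2 * R + 1) ^ d"
  unfolding int_box_eq card_Zd_coords by (simp add: nat_add_distrib nat_mult_distrib)

lemma Zd_diff: "x \<in> Zd d \<Longrightarrow> u \<in> Zd d \<Longrightarrow> (\<lambda>j. x j - u j) \<in> Zd d"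
  by (simp add: Zd_def)

lemma bij_betw_cube_box:
  assumes "x \<in> Zd d"
  shows "bij_betw (\<lambda>u j. x j - u j) (int_box d R) (int_cube d x R)"
  by (rule bij_betw_byWitness[where f' = "\<lambda>u j. x j - u j"])
    (use assms in \<open>auto simp: int_box_def int_cube_def Zd_def\<close>)

lemma sum_box_eq_sum_cube:
  "x \<in> Zd d \<Longrightarrow> (\<Sum>u\<in>int_box d R. g (\<lambda>j. x j - u j)) = (\<Sum>y\<in>int_cube d x R. g y)"
  by (rule sum.reindex_bij_betw[OF bij_betw_cube_box])

lemma finite_cube: "x \<in> Zd d \<Longrightarrow> finite (int_cube d x R)"
  using bij_betw_finite[OF bij_betw_cube_box[of x d R]] by simp

lemma card_cube: "x \<in> Zd d \<Longrightarrow> card (int_cube d x R) = (2 * R + 1) ^ d"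
  using bij_betw_same_card[OF bij_betw_cube_box[of x d R]] by (simp add: card_box)

lemma countable_Zd: "countable (Zd d)"
proof -
  have "Zd d \<subseteq> (\<Union>R. int_box d R)"
  proof
    fix u assume u: "u \<in> Zd d"
    have "\<bar>u j\<bar> \<le> int (nat (\<Sum>j<d. \<bar>u j\<bar>))" if "j < d" for j
      using that member_le_sum[of j "{..<d}" "\<lambda>j. \<bar>u j\<bar>"] by simp
    then have "u \<in> int_box d (nat (\<Sum>j<d. \<bar>u j\<bar>))" using u by (simp add: int_box_def)
    then show "u \<in> (\<Union>R. int_box d R)" by blast
  qed
  then show ?thesis
    by (rule countable_subset) (simp add: countable_finite)
qed

text \<open>
  The covering argument behind the weak type estimate.  Take a centre \<open>x\<close> whose radius is maximal.
  All centres whose cube meets the cube of \<open>x\<close> lie in the cube of twice the radius, which has at most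
  \<open>2 ^ d\<close> times as many points; the cubes of the remaining centres are disjoint from that of \<open>x\<close>, and
  induction applies to them.
\<close>

lemma card_le_sum_over_cubes:
  fixes g :: "(nat \<Rightarrow> int) \<Rightarrow> ennreal" and t :: ennreal
  assumes "finite K" "K \<subseteq> Zd d"
    and "\<And>x. x \<in> K \<Longrightarrow> t * of_nat (card (int_cube d x (\<rho> x))) \<le> (\<Sum>y\<in>int_cube d x (\<rho> x). g y)"
  shows "t * of_nat (card K) \<le> 2 ^ d * (\<Sum>y\<in>(\<Union>x\<in>K. int_cube d x (\<rho> x)). g y)"
  using assms
proof (induction K rule: finite_psubset_induct)
  case (psubset K)
  show ?case
  proof (cases "K = {}")
    case False
    obtain x where x: "x \<in> K" and max: "\<And>y. y \<in> K \<Longrightarrow> \<rho> y \<le> \<rho> x"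
    proof -
      have "Max (\<rho> ` K) \<in> \<rho> ` K" using psubset.hyps False by (intro Max_in) auto
      then obtain x where "x \<in> K" "\<rho> x = Max (\<rho> ` K)" by auto
      then show ?thesis using that[of x] psubset.hyps by simp
    qed
    have xd: "x \<in> Zd d" using x psubset.prems by auto
    define B where "B y = int_cube d y (\<rho> y)" for y
    define K1 where "K1 = {y\<in>K. B y \<inter> B x \<noteq> {}}"
    have finB: "finite (B y)" if "y \<in> K" for y
      using that psubset.prems by (auto simp: B_def intro: finite_cube)
    have "K1 \<subseteq> int_cube d x (2 * \<rho> x)"
    proof
      fix y assume y: "y \<in> K1"
      then obtain z where z: "z \<in> B y" "z \<in> B x" by (auto simp: K1_def)
      have "\<bar>x j - y j\<bar> \<le> int (2 * \<rho> x)" if "j < d" for j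
      proof -
        have "\<bar>y j - z j\<bar> \<le> int (\<rho> y)" "\<bar>x j - z j\<bar> \<le> int (\<rho> x)"
          using z that by (auto simp: B_def int_cube_def)
        moreover have "\<rho> y \<le> \<rho> x" using y max by (auto simp: K1_def)
        ultimately show ?thesis by linarith
      qed
      then show "y \<in> int_cube d x (2 * \<rho> x)"
        using y psubset.prems(1) by (auto simp: int_cube_def K1_def)
    qed
    then have "card K1 \<le> card (int_cube d x (2 * \<rho> x))"
      by (intro card_mono finite_cube xd)
    also have "\<dots> \<le> 2 ^ d * card (B x)"
      unfolding card_cube[OF xd] B_def power_mult_distrib[symmetric] by (intro power_mono) auto
    finally have "t * of_nat (card K1) \<le> t * of_nat (2 ^ d * card (B x))"
      by (intro mult_left_mono of_nat_mono) auto
    also have "\<dots> = 2 ^ d * (t * of_nat (card (B x)))" by (simp add: mult_ac)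
    also have "\<dots> \<le> 2 ^ d * (\<Sum>y\<in>B x. g y)"
      using psubset.prems(2)[OF x] by (intro mult_left_mono) (auto simp: B_def)
    finally have 1: "t * of_nat (card K1) \<le> 2 ^ d * (\<Sum>y\<in>B x. g y)" .
    have "x \<in> B x" using xd by (simp add: B_def int_cube_def)
    then have "x \<in> K1" using x by (auto simp: K1_def)
    then have "K - K1 \<subset> K" using x by auto
    then have 2: "t * of_nat (card (K - K1)) \<le> 2 ^ d * (\<Sum>y\<in>(\<Union>x\<in>K - K1. B x). g y)"
      unfolding B_def using psubset.prems by (intro psubset.IH) auto
    have disj: "B x \<inter> (\<Union>x\<in>K - K1. B x) = {}" by (auto simp: K1_def)
    have "K \<inter> K1 = K1" by (auto simp: K1_def)
    then have "card K = card K1 + card (K - K1)"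
      using card_Int_Diff[of K K1] psubset.hyps by simp
    then have "t * of_nat (card K) = t * of_nat (card K1) + t * of_nat (card (K - K1))"
      by (simp add: distrib_left)
    also have "\<dots> \<le> 2 ^ d * (\<Sum>y\<in>B x. g y) + 2 ^ d * (\<Sum>y\<in>(\<Union>x\<in>K - K1. B x). g y)"
      by (intro add_mono 1 2)
    also have "\<dots> = 2 ^ d * (\<Sum>y\<in>B x \<union> (\<Union>x\<in>K - K1. B x). g y)"
    proof -
      have "finite (\<Union>x\<in>K - K1. B x)" using psubset.hyps finB by blast
      then show ?thesis
        using sum.union_disjoint[OF finB[OF x] _ disj, of g] by (simp add: distrib_left)
    qed
    also have "\<dots> \<le> 2 ^ d * (\<Sum>y\<in>(\<Union>x\<in>K. B x). g y)"
    proof -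
      have "finite (\<Union>x\<in>K. B x)" using psubset.hyps finB by blast
      moreover have "B x \<union> (\<Union>x\<in>K - K1. B x) \<subseteq> (\<Union>x\<in>K. B x)" using x by blast
      ultimately show ?thesis by (intro mult_left_mono sum_mono2) simp_all
    qed
    finally show ?thesis unfolding B_def .
  qed simp
qed

lemma sum_le_nn_integral_count_space:
  fixes g :: "'a \<Rightarrow> ennreal"
  assumes "B \<subseteq> A" "finite B"
  shows "(\<Sum>y\<in>B. g y) \<le> (\<integral>\<^sup>+y. g y \<partial>count_space A)"
proof -
  have "(\<Sum>y\<in>B. g y) = (\<integral>\<^sup>+y. g y * indicator B y \<partial>count_space A)"
    using assms by (subst nn_integral_count_space'[of B]) (auto intro!: sum.cong)
  also have "\<dots> \<le> (\<integral>\<^sup>+y. g y \<partial>count_space A)"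
    by (intro nn_integral_mono) (auto split: split_indicator)
  finally show ?thesis .
qed

text \<open>
  At each point of the level set some average exceeds \<open>t\<close>, so the covering lemma bounds the
  cardinality of every finite subset of the level set.
\<close>

lemma HL_max_weak_type:
  assumes t: "t > 0"
  shows "ennreal t * (\<integral>\<^sup>+x. (if ennreal t < HL_max d g x then 1 else 0) \<partial>count_space (Zd d))
    \<le> 2 ^ d * (\<integral>\<^sup>+y. g y \<partial>count_space (Zd d))"
proof -
  define X where "X = 2 ^ d * (\<integral>\<^sup>+y. g y \<partial>count_space (Zd d))"
  define E where "E = {x \<in> Zd d. ennreal t < HL_max d g x}"
  have "\<exists>R. ennreal t * of_nat (card (int_cube d x R)) \<le> (\<Sum>y\<in>int_cube d x R. g y)" if x: "x \<in> E" for x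
  proof -
    have xd: "x \<in> Zd d" and "ennreal t < HL_max d g x" using x by (auto simp: E_def)
    then obtain R where R: "ennreal t < (\<Sum>u\<in>int_box d R. g (\<lambda>j. x j - u j)) / ennreal ((2 * real R + 1) ^ d)"
      by (auto simp: HL_max_def less_SUP_iff)
    define b where "b = ennreal ((2 * real R + 1) ^ d)"
    have b: "b \<noteq> 0" "b \<noteq> top" by (auto simp: b_def ennreal_eq_0_iff not_le)
    have "ennreal t * b \<le> (\<Sum>y\<in>int_cube d x R. g y) / b * b"
      using R xd by (intro mult_right_mono) (auto simp: b_def sum_box_eq_sum_cube less_imp_le)
    also have "\<dots> = (\<Sum>y\<in>int_cube d x R. g y)"
      using b by (simp add: ennreal_divide_times less_top)
    also have "b = of_nat (card (int_cube d x R))"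
      using xd by (simp add: b_def card_cube ennreal_of_nat_eq_real_of_nat add.commute)
    finally show ?thesis by auto
  qed
  then obtain \<rho> where \<rho>: "\<And>x. x \<in> E \<Longrightarrow> ennreal t * of_nat (card (int_cube d x (\<rho> x))) \<le> (\<Sum>y\<in>int_cube d x (\<rho> x). g y)"
    by metis
  have fin: "ennreal t * of_nat (card K) \<le> X" if K: "finite K" "K \<subseteq> E" for K
  proof -
    have "ennreal t * of_nat (card K) \<le> 2 ^ d * (\<Sum>y\<in>(\<Union>x\<in>K. int_cube d x (\<rho> x)). g y)"
      using K \<rho> by (intro card_le_sum_over_cubes) (auto simp: E_def)
    also have "\<dots> \<le> X"
    proof -
      have "K \<subseteq> Zd d" using K by (auto simp: E_def)
      then have "finite (\<Union>x\<in>K. int_cube d x (\<rho> x))" using K finite_cube by blast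
      moreover have "(\<Union>x\<in>K. int_cube d x (\<rho> x)) \<subseteq> Zd d" by (auto simp: int_cube_def)
      ultimately show ?thesis
        unfolding X_def by (intro mult_left_mono sum_le_nn_integral_count_space) auto
    qed
    finally show ?thesis .
  qed
  have int: "(\<integral>\<^sup>+x. (if ennreal t < HL_max d g x then 1 else 0) \<partial>count_space (Zd d)) = emeasure (count_space (Zd d)) E"
  proof -
    have 1: "emeasure (count_space (Zd d)) E = (\<integral>\<^sup>+x. indicator E x \<partial>count_space (Zd d))"
      by (subst nn_integral_indicator) (auto simp: E_def)
    show ?thesis
      unfolding 1 by (intro nn_integral_cong) (auto simp: E_def split: split_indicator)
  qed
  show ?thesis
  proof (cases "finite E")
    case True
    then have "emeasure (count_space (Zd d)) E = of_nat (card E)"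
      by (intro emeasure_count_space_finite) (auto simp: E_def)
    then show ?thesis using fin[OF True] int by (simp add: X_def)
  next
    case False
    have "X = top"
    proof (rule ccontr)
      assume "X \<noteq> top"
      then obtain r where r: "X = ennreal r" "r \<ge> 0" by (cases X) auto
      obtain n :: nat where n: "r < real n * t" using reals_Archimedean3[OF t] by blast
      obtain K where "finite K" "card K = n" "K \<subseteq> E"
        using infinite_arbitrarily_large[OF False] by blast
      then have "ennreal t * of_nat n \<le> ennreal r" using fin r by auto
      then have "t * real n \<le> r"
        using t r by (simp add: ennreal_of_nat_eq_real_of_nat flip: ennreal_mult)
      then show False using n by (simp add: mult.commute)
    qed
    then show ?thesis by (simp add: X_def)
  qed
qed

text \<open>
  Integrating the derivative of \<open>s powr a\<close> up to \<open>t\<close>; at \<open>t = \<infinity>\<close> both sides are infinite by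
  monotonicity.
\<close>

lemma nn_integral_layer_cake:
  assumes a: "a > 0"
  shows "(\<integral>\<^sup>+s. ennreal (a * s powr (a - 1)) * (if 0 \<le> s \<and> ennreal s \<le> t then 1 else 0) \<partial>lborel)
    = epowr t a" (is "?I t = _")
proof -
  have fin: "?I (ennreal T) = ennreal (T powr a)" if T: "T \<ge> 0" for T
  proof -
    have "((\<lambda>s. a * s powr (a - 1)) has_integral a * (T powr (a - 1 + 1) / (a - 1 + 1))) {0..T}"
      using a T by (intro has_integral_mult_right has_integral_powr_from_0) auto
    then have "((\<lambda>s. a * s powr (a - 1)) has_integral T powr a) {0..T}" using a by simp
    then have "(\<integral>\<^sup>+s. ennreal (a * s powr (a - 1)) * indicator {0..T} s \<partial>lborel) = ennreal (T powr a)"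
      using a by (intro nn_integral_has_integral_lebesgue') auto
    moreover have "?I (ennreal T) = (\<integral>\<^sup>+s. ennreal (a * s powr (a - 1)) * indicator {0..T} s \<partial>lborel)"
      using T by (intro nn_integral_cong) (auto split: split_indicator)
    ultimately show ?thesis by simp
  qed
  show ?thesis
  proof (cases t)
    case (real T)
    then show ?thesis using fin by (simp add: epowr_ennreal)
  next
    case top
    have le: "ennreal (T powr a) \<le> ?I top" if "T \<ge> 0" for T
      unfolding fin[OF that, symmetric] by (intro nn_integral_mono mult_left_mono) auto
    have "?I top = top"
    proof (rule ccontr)
      assume "?I top \<noteq> top"
      then obtain r where r: "?I top = ennreal r" "r \<ge> 0" by (cases "?I top") auto
      show False
        using le[of "(r + 1) powr (1 / a)"] r a by (simp add: powr_powr)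
    qed
    then show ?thesis using top by simp
  qed
qed

lemma HL_max_truncation:
  assumes "\<And>y. g y \<le> h y + s"
  shows "HL_max d g x \<le> HL_max d h x + s"
  unfolding HL_max_def[of d g]
proof (rule SUP_least)
  fix R :: nat
  define b where "b = ennreal ((2 * real R + 1) ^ d)"
  have b: "b \<noteq> 0" "b \<noteq> top" by (auto simp: b_def ennreal_eq_0_iff not_le)
  have card: "of_nat (card (int_box d R)) = b"
    by (simp add: b_def card_box ennreal_of_nat_eq_real_of_nat add.commute)
  have "(\<Sum>u\<in>int_box d R. g (\<lambda>j. x j - u j)) / b \<le> (\<Sum>u\<in>int_box d R. h (\<lambda>j. x j - u j) + s) / b"
    using assms by (intro divide_right_mono_ennreal sum_mono)
  also have "\<dots> = (\<Sum>u\<in>int_box d R. h (\<lambda>j. x j - u j)) / b + b * s / b"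
    by (simp add: sum.distrib add_divide_distrib_ennreal card)
  also have "b * s / b = s"
    using b by (simp add: mult.commute[of b s] ennreal_mult_divide_eq)
  also have "(\<Sum>u\<in>int_box d R. h (\<lambda>j. x j - u j)) / b \<le> HL_max d h x"
    unfolding HL_max_def b_def by (rule SUP_upper) simp
  finally show "(\<Sum>u\<in>int_box d R. g (\<lambda>j. x j - u j)) / ennreal ((2 * real R + 1) ^ d) \<le> HL_max d h x + s"
    by (simp add: b_def)
qed

text \<open>
  The part of \<open>g\<close> below \<open>s / 4\<close> raises the maximal function by at most \<open>s / 4\<close>.  Where the maximal
  function of \<open>g\<close> is at least \<open>s\<close>, that of the remaining part \<open>h\<close> hence exceeds \<open>s / 4\<close>, and the
  weak type bound applies to \<open>h\<close>.
\<close>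

lemma HL_max_level_set:
  assumes s: "s > 0"
  shows "(\<integral>\<^sup>+x. (if ennreal s \<le> HL_max d g x then 1 else 0) \<partial>count_space (Zd d))
    \<le> ennreal (4 * 2 ^ d / s) * (\<integral>\<^sup>+y. g y * (if ennreal s \<le> 4 * g y then 1 else 0) \<partial>count_space (Zd d))"
    (is "?W \<le> _ * ?G")
proof -
  define h where "h y = g y * (if ennreal s \<le> 4 * g y then 1 else 0)" for y
  have "g y \<le> h y + ennreal (s / 4)" for y
  proof (cases "ennreal s \<le> 4 * g y")
    case False
    then have "g y \<noteq> top" by (auto simp: ennreal_mult_top)
    then obtain r where r: "g y = ennreal r" "r \<ge> 0" by (cases "g y") auto
    have "4 * g y = ennreal (4 * r)" using r by (simp add: ennreal_mult)
    then have "r \<le> s / 4" using False r s by (simp add: ennreal_le_iff)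
    then show ?thesis using r by (simp add: h_def ennreal_leI)
  qed (simp add: h_def)
  then have HL: "HL_max d g x \<le> HL_max d h x + ennreal (s / 4)" for x by (rule HL_max_truncation)
  have "ennreal (s / 4) < HL_max d h x" if "ennreal s \<le> HL_max d g x" for x
  proof (rule ccontr)
    assume "\<not> ?thesis"
    then have "ennreal s \<le> ennreal (s / 4) + ennreal (s / 4)"
      using that HL[of x] by (meson add_right_mono not_le order_trans)
    then have "s \<le> s / 4 + s / 4" using s by (simp flip: ennreal_plus)
    then show False using s by simp
  qed
  then have "?W \<le> (\<integral>\<^sup>+x. (if ennreal (s / 4) < HL_max d h x then 1 else 0) \<partial>count_space (Zd d))"
    by (intro nn_integral_mono) auto
  also have "\<dots> = ennreal (4 / s) * (ennreal (s / 4) * \<dots>)"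
    using s by (simp add: mult.assoc[symmetric] flip: ennreal_mult)
  also have "\<dots> \<le> ennreal (4 / s) * (2 ^ d * ?G)"
    using s HL_max_weak_type[of "s / 4" d h] by (intro mult_left_mono) (auto simp: h_def)
  also have "\<dots> = ennreal (4 * 2 ^ d / s) * ?G"
  proof -
    have "ennreal (4 * 2 ^ d / s) = ennreal (4 / s) * 2 ^ d"
      using s by (simp add: ennreal_power ennreal_mult[symmetric] flip: ennreal_numeral) 
    then show ?thesis by (simp add: mult.assoc)
  qed
  finally show ?thesis .
qed

text \<open>
  Marcinkiewicz interpolation: write the power \<open>p\<close> of the maximal function as an integral over its
  levels \<open>s\<close>, estimate each level set by the preceding lemma, and exchange sum and integral.  The
  weight \<open>s powr (p - 1) / s\<close> that remains is the layer cake weight of exponent \<open>p - 1 > 0\<close>, so the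
  inner integral returns \<open>g\<close> to the power \<open>p - 1\<close>.
\<close>

lemma HL_max_strong_type:
  assumes p: "p > 1"
  shows "(\<integral>\<^sup>+x. epowr (HL_max d g x) p \<partial>count_space (Zd d))
    \<le> ennreal (4 powr p * (2 ^ d * p / (p - 1))) * (\<integral>\<^sup>+x. epowr (g x) p \<partial>count_space (Zd d))"
proof -
  define \<phi> where "\<phi> a s = ennreal (a * s powr (a - 1))" for a s :: real
  define K where "K = 4 * (2 ^ d * p / (p - 1))"
  have K: "K \<ge> 0" using p by (simp add: K_def)
  let ?M = "count_space (Zd d)"
  have [measurable]: "\<phi> a \<in> borel_measurable borel" for a
    unfolding \<phi>_def by measurable
  have cake: "epowr t a = (\<integral>\<^sup>+s. \<phi> a s * (if 0 \<le> s \<and> ennreal s \<le> t then 1 else 0) \<partial>lborel)"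
    if "a > 0" for a t
    using nn_integral_layer_cake[OF that, of t] by (simp add: \<phi>_def)
  have "(\<integral>\<^sup>+x. epowr (HL_max d g x) p \<partial>?M)
      = (\<integral>\<^sup>+x. \<integral>\<^sup>+s. \<phi> p s * (if 0 \<le> s \<and> ennreal s \<le> HL_max d g x then 1 else 0) \<partial>lborel \<partial>?M)"
    using p by (simp add: cake)
  also have "\<dots> = (\<integral>\<^sup>+s. \<integral>\<^sup>+x. \<phi> p s * (if 0 \<le> s \<and> ennreal s \<le> HL_max d g x then 1 else 0) \<partial>?M \<partial>lborel)"
    by (rule nn_integral_count_space_nn_integral[symmetric]) (auto intro: countable_Zd)
  also have "\<dots> \<le> (\<integral>\<^sup>+s. \<integral>\<^sup>+x. ennreal K * g x * (\<phi> (p - 1) s * (if 0 \<le> s \<and> ennreal s \<le> 4 * g x then 1 else 0)) \<partial>?M \<partial>lborel)"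
  proof (rule nn_integral_mono)
    fix s :: real
    show "(\<integral>\<^sup>+x. \<phi> p s * (if 0 \<le> s \<and> ennreal s \<le> HL_max d g x then 1 else 0) \<partial>?M)
       \<le> (\<integral>\<^sup>+x. ennreal K * g x * (\<phi> (p - 1) s * (if 0 \<le> s \<and> ennreal s \<le> 4 * g x then 1 else 0)) \<partial>?M)"
    proof (cases "s > 0")
      case True
      let ?G = "\<integral>\<^sup>+x. g x * (if ennreal s \<le> 4 * g x then 1 else 0) \<partial>?M"
      have "(\<integral>\<^sup>+x. \<phi> p s * (if 0 \<le> s \<and> ennreal s \<le> HL_max d g x then 1 else 0) \<partial>?M)
          = \<phi> p s * (\<integral>\<^sup>+x. (if ennreal s \<le> HL_max d g x then 1 else 0) \<partial>?M)"
        using True by (subst nn_integral_cmult[symmetric]) (auto intro!: nn_integral_cong)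
      also have "\<dots> \<le> \<phi> p s * (ennreal (4 * 2 ^ d / s) * ?G)"
        using True by (intro mult_left_mono HL_max_level_set) auto
      also have "\<phi> p s * (ennreal (4 * 2 ^ d / s) * ?G) = ennreal (p * s powr (p - 1) * (4 * 2 ^ d / s)) * ?G"
        using True p by (simp add: \<phi>_def mult.assoc[symmetric] flip: ennreal_mult)
      also have "p * s powr (p - 1) * (4 * 2 ^ d / s) = K * ((p - 1) * s powr (p - 1 - 1))"
      proof -
        have "s powr (p - 1 - 1) = s powr (p - 1) / s" using True powr_diff[of s "p - 1" 1] by simp
        then show ?thesis using p by (simp add: K_def)
      qed
      also have "ennreal (K * ((p - 1) * s powr (p - 1 - 1))) * ?G = ennreal K * \<phi> (p - 1) s * ?G"
        using K p by (simp add: \<phi>_def ennreal_mult)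
      also have "\<dots> = (\<integral>\<^sup>+x. ennreal K * g x * (\<phi> (p - 1) s * (if 0 \<le> s \<and> ennreal s \<le> 4 * g x then 1 else 0)) \<partial>?M)"
        using True by (subst nn_integral_cmult[symmetric]) (auto intro!: nn_integral_cong simp: mult_ac)
      finally show ?thesis .
    next
      case False
      then have "\<phi> p s * (if 0 \<le> s \<and> ennreal s \<le> HL_max d g x then 1 else 0) = 0" for x
        by (auto simp: \<phi>_def)
      then show ?thesis by (simp only: nn_integral_const mult_zero_left zero_le)
    qed
  qed
  also have "\<dots> = (\<integral>\<^sup>+x. \<integral>\<^sup>+s. ennreal K * g x * (\<phi> (p - 1) s * (if 0 \<le> s \<and> ennreal s \<le> 4 * g x then 1 else 0)) \<partial>lborel \<partial>?M)"
    by (rule nn_integral_count_space_nn_integral) (auto intro: countable_Zd)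
  also have "\<dots> = (\<integral>\<^sup>+x. ennreal K * g x * epowr (4 * g x) (p - 1) \<partial>?M)"
    using p by (intro nn_integral_cong) (simp add: cake nn_integral_cmult)
  also have "\<dots> = (\<integral>\<^sup>+x. ennreal (K * 4 powr (p - 1)) * epowr (g x) p \<partial>?M)"
  proof (rule nn_integral_cong)
    fix x
    have "epowr (g x) p = g x * epowr (g x) (p - 1)"
      using epowr_add[of "g x" 1 "p - 1"] by simp
    moreover have "epowr 4 (p - 1) = ennreal (4 powr (p - 1))"
      using epowr_ennreal[of 4 "p - 1"] by simp
    ultimately show "ennreal K * g x * epowr (4 * g x) (p - 1) = ennreal (K * 4 powr (p - 1)) * epowr (g x) p"
      using K by (simp add: epowr_mult ennreal_mult mult_ac)
  qed
  also have "\<dots> = ennreal (K * 4 powr (p - 1)) * (\<integral>\<^sup>+x. epowr (g x) p \<partial>?M)"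
    by (rule nn_integral_cmult) simp
  also have "K * 4 powr (p - 1) = 4 powr p * (2 ^ d * p / (p - 1))"
  proof -
    have *: "4 * X * (Y / 4) = Y * X" for X Y :: real by simp
    have "4 powr (p - 1) = 4 powr p / (4::real)" by (simp add: powr_diff)
    then show ?thesis unfolding K_def by (simp only: *)
  qed
  finally show ?thesis .
qed

theorem HL_max_bounded:
  assumes c: "0 \<le> c" "c < 1"
  shows "\<exists>K>0. \<forall>g. recip_norm c (Zd d) (HL_max d g) \<le> ennreal K * recip_norm c (Zd d) g"
proof (cases "c = 0")
  case True
  have "HL_max d g x \<le> recip_norm 0 (Zd d) g" if x: "x \<in> Zd d" for g x
    unfolding HL_max_def
  proof (rule SUP_least)
    fix R :: nat
    define S where "S = recip_norm 0 (Zd d) g"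
    define b where "b = ennreal ((2 * real R + 1) ^ d)"
    have b: "b \<noteq> 0" "b \<noteq> top" by (auto simp: b_def ennreal_eq_0_iff not_le)
    have "(\<Sum>u\<in>int_box d R. g (\<lambda>j. x j - u j)) \<le> (\<Sum>u\<in>int_box d R. S)"
      unfolding S_def using x
      by (intro sum_mono le_recip_norm[of 0 _ "Zd d" g]) (auto simp: int_box_def intro: Zd_diff)
    also have "\<dots> = S * b"
      using card_box[of d R] by (simp add: b_def ennreal_of_nat_eq_real_of_nat mult.commute[of S] add.commute)
    finally have "(\<Sum>u\<in>int_box d R. g (\<lambda>j. x j - u j)) / b \<le> S * b / b"
      by (rule divide_right_mono_ennreal)
    also have "S * b / b = S" using b by (simp add: ennreal_mult_divide_eq)
    finally show "(\<Sum>u\<in>int_box d R. g (\<lambda>j. x j - u j)) / ennreal ((2 * real R + 1) ^ d) \<le> recip_norm 0 (Zd d) g"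
      by (simp add: S_def b_def)
  qed
  then have "recip_norm 0 (Zd d) (HL_max d g) \<le> recip_norm 0 (Zd d) g" for g
    by (simp add: recip_norm_def[of 0 _ "HL_max d g"] SUP_least)
  then show ?thesis using True by (intro exI[of _ 1]) simp
next
  case False
  with c have c0: "c > 0" by simp
  define p where "p = 1 / c"
  have p: "p > 1" using c0 c by (simp add: p_def)
  define K where "K = 4 powr p * (2 ^ d * p / (p - 1))"
  have K: "K > 0" using p by (simp add: K_def)
  have "recip_norm c (Zd d) (HL_max d g) \<le> ennreal (K powr c) * recip_norm c (Zd d) g" for g
  proof -
    have "recip_norm c (Zd d) (HL_max d g) \<le> epowr (ennreal K * (\<integral>\<^sup>+x. epowr (g x) p \<partial>count_space (Zd d))) c"
      unfolding recip_norm_def K_def p_def[symmetric]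
      using c0 HL_max_strong_type[OF p, of d g] by (auto intro: epowr_mono)
    also have "\<dots> = ennreal (K powr c) * recip_norm c (Zd d) g"
      using c0 K unfolding recip_norm_def p_def[symmetric] by (simp add: epowr_mult epowr_ennreal)
    finally show ?thesis .
  qed
  then show ?thesis using K by (intro exI[of _ "K powr c"]) auto
qed

section \<open>Slicing the multilinear average\<close>

text \<open>
  The multilinear maximal operator on \<open>[0,\<infinity>]\<close>-valued functions.  Taking absolute values of the
  arguments makes the kernel positive, which is what slicing and interpolation rely on.
\<close>

definition avg_max ::
  "nat \<Rightarrow> nat \<Rightarrow> nat \<Rightarrow> (nat \<Rightarrow> (nat \<Rightarrow> int) \<Rightarrow> ennreal) \<Rightarrow> (nat \<Rightarrow> int) \<Rightarrow> ennreal" where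
  "avg_max d k m g x =
     (SUP n\<in>{n. n \<ge> 1 \<and> N_sphere d k m n > 0}.
        (\<Sum>u\<in>sphere_tuples d k m n. \<Prod>i<m. g i (\<lambda>j. x j - u i j)) / of_nat (N_sphere d k m n))"

text \<open>
  The radius is an integer rather than a natural number because slicing produces \<open>n\<close> minus the
  contribution of the other variables, which may be negative; the sphere is then empty.
\<close>

definition int_sphere :: "nat \<Rightarrow> nat \<Rightarrow> int \<Rightarrow> (nat \<Rightarrow> int) set" where
  "int_sphere d k z = {w \<in> Zd d. kpow d k w = z}"

text \<open>
  In contrast to the linear case of \<^const>\<open>T_max\<close>, the radius \<open>z = 0\<close> takes part: it occurs when
  the other variables exhaust the whole radius.
\<close>

definition sphere_max ::
  "nat \<Rightarrow> nat \<Rightarrow> ((nat \<Rightarrow> int) \<Rightarrow> ennreal) \<Rightarrow> (nat \<Rightarrow> int) \<Rightarrow> ennreal" where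
  "sphere_max d k g x =
     (SUP z\<in>{z. int_sphere d k z \<noteq> {}}. (\<Sum>w\<in>int_sphere d k z. g (\<lambda>j. x j - w j)) / of_nat (card (int_sphere d k z)))"

lemma kpow_nonneg: "0 \<le> kpow d k w"
  by (auto simp: kpow_def intro!: sum_nonneg)

lemma abs_coord_power_le_kpow: "j < d \<Longrightarrow> \<bar>w j\<bar> ^ k \<le> kpow d k w"
  unfolding kpow_def by (intro member_le_sum) auto

lemma mem_box_if_kpow_le:
  assumes k: "k \<ge> 1" and w: "w \<in> Zd d" "kpow d k w \<le> int n"
  shows "w \<in> int_box d (nat \<lfloor>root k (real n)\<rfloor>)"
proof -
  have "\<bar>w j\<bar> \<le> int (nat \<lfloor>root k (real n)\<rfloor>)" if "j < d" for j
  proof -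
    have "\<bar>w j\<bar> ^ k \<le> int n" using abs_coord_power_le_kpow[OF that, of w k] w by simp
    then have "real_of_int \<bar>w j\<bar> ^ k \<le> real n"
      by (metis of_int_le_iff of_int_of_nat_eq of_int_power)
    then have "root k (real_of_int \<bar>w j\<bar> ^ k) \<le> root k (real n)"
      using k by (intro real_root_le_mono) auto
    then have "real_of_int \<bar>w j\<bar> \<le> root k (real n)"
      using k by (simp add: real_root_power_cancel)
    then have "\<bar>w j\<bar> \<le> \<lfloor>root k (real n)\<rfloor>" by (simp add: le_floor_iff)
    then show ?thesis by linarith
  qed
  then show ?thesis using w by (simp add: int_box_def)
qed

lemma finite_int_sphere: "k \<ge> 1 \<Longrightarrow> finite (int_sphere d k z)"
proof (rule finite_subset)
  assume k: "k \<ge> 1"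
  show "int_sphere d k z \<subseteq> int_box d (nat \<lfloor>root k (real (nat z))\<rfloor>)"
    using k by (auto simp: int_sphere_def intro!: mem_box_if_kpow_le)
qed simp

lemma int_sphere_0:
  assumes k: "k \<ge> 1"
  shows "int_sphere d k 0 = {\<lambda>_. 0}"
proof
  show "int_sphere d k 0 \<subseteq> {\<lambda>_. 0}"
  proof
    fix w assume w: "w \<in> int_sphere d k 0"
    have "w j = 0" for j
    proof (cases "j < d")
      case True
      then have "\<bar>w j\<bar> ^ k \<le> 0"
        using abs_coord_power_le_kpow[OF True, of w k] w by (simp add: int_sphere_def)
      then have "\<bar>w j\<bar> ^ k = 0" using zero_le_power[of "\<bar>w j\<bar>" k] by linarith
      then show ?thesis by simp
    next
      case False
      then show ?thesis using w by (simp add: int_sphere_def Zd_def)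
    qed
    then show "w \<in> {\<lambda>_. 0}" by auto
  qed
  show "{\<lambda>_. 0} \<subseteq> int_sphere d k 0" using k by (simp add: int_sphere_def Zd_def kpow_def)
qed

lemma bij_betw_sphere_tuples_1: "bij_betw (\<lambda>u. u 0) (sphere_tuples d k 1 n) (int_sphere d k (int n))"
  by (rule bij_betw_byWitness[where f' = "\<lambda>w. restrict (\<lambda>_. w) {..<1}"])
    (auto simp: sphere_tuples_def int_sphere_def fun_eq_iff PiE_def extensional_def restrict_def)

lemma N_sphere_1: "N_sphere d k 1 n = card (int_sphere d k (int n))"
  unfolding N_sphere_def by (rule bij_betw_same_card[OF bij_betw_sphere_tuples_1])

text \<open>
  Slicing: a tuple on the sphere of radius \<open>n\<close> is determined by its entries other than \<open>u j\<close>, each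
  of which lies in the box, together with \<open>u j\<close>, which lies on a linear sphere of the remaining
  radius.  Dropping all other constraints leaves a product of box sums times sphere sums.
\<close>

lemma sum_sphere_tuples_le:
  fixes g :: "nat \<Rightarrow> (nat \<Rightarrow> int) \<Rightarrow> ennreal"
  assumes k: "k \<ge> 1" and j: "j < l"
    and R: "\<And>w. w \<in> Zd d \<Longrightarrow> kpow d k w \<le> int n \<Longrightarrow> w \<in> int_box d R"
    and B: "\<And>z. z \<le> int n \<Longrightarrow> (\<Sum>w\<in>int_sphere d k z. g j (\<lambda>j. x j - w j)) \<le> B"
  shows "(\<Sum>u\<in>sphere_tuples d k l n. \<Prod>i<l. g i (\<lambda>j. x j - u i j))
    \<le> B * (\<Prod>i\<in>{..<l} - {j}. \<Sum>w\<in>int_box d R. g i (\<lambda>j. x j - w j))"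
proof -
  define I where "I = {..<l} - {j}"
  have I: "finite I" "j \<notin> I" "{..<l} = insert j I" using j by (auto simp: I_def)
  define V where "V = (I \<rightarrow>\<^sub>E int_box d R)"
  define W where "W v = int_sphere d k (int n - (\<Sum>i\<in>I. kpow d k (v i)))" for v
  define P where "P v = (\<Prod>i\<in>I. g i (\<lambda>j. x j - v i j))" for v
  have finV: "finite V" unfolding V_def using I by (intro finite_PiE) auto
  have finW: "finite (W v)" for v unfolding W_def using k by (rule finite_int_sphere)
  have mem: "restrict u I \<in> V \<and> u j \<in> W (restrict u I) \<and> (restrict u I)(j := u j) = u
      \<and> (\<Prod>i<l. g i (\<lambda>j. x j - u i j)) = g j (\<lambda>i. x i - u j i) * P (restrict u I)"
    if u: "u \<in> sphere_tuples d k l n" for u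
  proof -
    have uZ: "u i \<in> Zd d" if "i < l" for i using u that by (auto simp: sphere_tuples_def)
    have sum: "(\<Sum>i<l. kpow d k (u i)) = int n" using u by (simp add: sphere_tuples_def)
    have ext: "u i = undefined" if "i \<ge> l" for i
      using u that by (auto simp: sphere_tuples_def PiE_def extensional_def)
    have "kpow d k (u i) \<le> int n" if "i < l" for i
      unfolding sum[symmetric] using that kpow_nonneg by (intro member_le_sum) auto
    then have 1: "restrict u I \<in> V" using R uZ by (auto simp: V_def I_def)
    have "kpow d k (u j) = int n - (\<Sum>i\<in>I. kpow d k (u i))" using sum I by simp
    then have 2: "u j \<in> W (restrict u I)" using uZ j by (simp add: W_def int_sphere_def)
    have 3: "(restrict u I)(j := u j) = u"
    proof
      fix i show "((restrict u I)(j := u j)) i = u i"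
        using ext[of i] by (auto simp: I_def)
    qed
    show ?thesis using 1 2 3 I by (simp add: P_def)
  qed
  have "(\<Sum>u\<in>sphere_tuples d k l n. \<Prod>i<l. g i (\<lambda>j. x j - u i j))
      \<le> (\<Sum>(v, w)\<in>Sigma V W. g j (\<lambda>i. x i - w i) * P v)"
  proof (rule sum_le_included[where i = "\<lambda>(v, w). v(j := w)"])
    show "finite (Sigma V W)" using finV finW by (rule finite_SigmaI)
    then have "finite ((\<lambda>(v, w). v(j := w)) ` Sigma V W)" by (rule finite_imageI)
    moreover have "sphere_tuples d k l n \<subseteq> (\<lambda>(v, w). v(j := w)) ` Sigma V W"
    proof
      fix u assume "u \<in> sphere_tuples d k l n"
      from mem[OF this] show "u \<in> (\<lambda>(v, w). v(j := w)) ` Sigma V W"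
        by (intro image_eqI[of _ _ "(restrict u I, u j)"]) auto
    qed
    ultimately show "finite (sphere_tuples d k l n)" by (rule finite_subset[rotated])
    show "\<forall>u\<in>sphere_tuples d k l n. \<exists>vw\<in>Sigma V W. (case vw of (v, w) \<Rightarrow> v(j := w)) = u \<and>
        (\<Prod>i<l. g i (\<lambda>j. x j - u i j)) \<le> (case vw of (v, w) \<Rightarrow> g j (\<lambda>i. x i - w i) * P v)"
    proof
      fix u assume "u \<in> sphere_tuples d k l n"
      from mem[OF this] show "\<exists>vw\<in>Sigma V W. (case vw of (v, w) \<Rightarrow> v(j := w)) = u \<and>
          (\<Prod>i<l. g i (\<lambda>j. x j - u i j)) \<le> (case vw of (v, w) \<Rightarrow> g j (\<lambda>i. x i - w i) * P v)"
        by (intro bexI[of _ "(restrict u I, u j)"]) auto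
    qed
  qed auto
  also have "\<dots> = (\<Sum>v\<in>V. (\<Sum>w\<in>W v. g j (\<lambda>i. x i - w i)) * P v)"
    using finV finW by (simp add: sum.Sigma[symmetric] sum_distrib_right)
  also have "\<dots> \<le> (\<Sum>v\<in>V. B * P v)"
  proof (intro sum_mono mult_right_mono)
    fix v
    have "0 \<le> (\<Sum>i\<in>I. kpow d k (v i))" by (intro sum_nonneg kpow_nonneg)
    then show "(\<Sum>w\<in>W v. g j (\<lambda>i. x i - w i)) \<le> B" unfolding W_def by (intro B) simp
  qed simp
  also have "\<dots> = B * (\<Prod>i\<in>I. \<Sum>w\<in>int_box d R. g i (\<lambda>j. x j - w j))"
    unfolding V_def P_def using I
    by (subst prod_sum_PiE) (auto simp: sum_distrib_left)
  finally show ?thesis by (simp add: I_def)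
qed

lemma ennreal_divide_mult_cancel:
  fixes a b :: ennreal
  shows "b \<noteq> 0 \<Longrightarrow> b \<noteq> top \<Longrightarrow> a / b * b = a"
  by (simp add: ennreal_divide_times less_top)

lemma sum_int_sphere_le_sphere_max:
  assumes k: "k \<ge> 1" 
  shows "(\<Sum>w\<in>int_sphere d k z. g (\<lambda>j. x j - w j)) \<le> of_nat (card (int_sphere d k z)) * sphere_max d k g x"
proof (cases "int_sphere d k z = {}")
  case False
  have "card (int_sphere d k z) > 0" using False finite_int_sphere[OF k] by (simp add: card_gt_0_iff)
  then have "(\<Sum>w\<in>int_sphere d k z. g (\<lambda>j. x j - w j))
      = (\<Sum>w\<in>int_sphere d k z. g (\<lambda>j. x j - w j)) / of_nat (card (int_sphere d k z)) * of_nat (card (int_sphere d k z))"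
    by (intro ennreal_divide_mult_cancel[symmetric]) auto
  also have "\<dots> \<le> sphere_max d k g x * of_nat (card (int_sphere d k z))"
    unfolding sphere_max_def using False by (intro mult_right_mono SUP_upper) auto
  finally show ?thesis by (simp only: mult.commute)
qed simp

lemma sum_box_le_HL_max:
  "(\<Sum>u\<in>int_box d R. g (\<lambda>j. x j - u j)) \<le> ennreal ((2 * real R + 1) ^ d) * HL_max d g x"
proof -
  define b where "b = ennreal ((2 * real R + 1) ^ d)"
  have b: "b \<noteq> 0" "b \<noteq> top" by (auto simp: b_def ennreal_eq_0_iff not_le)
  have "(\<Sum>u\<in>int_box d R. g (\<lambda>j. x j - u j)) = (\<Sum>u\<in>int_box d R. g (\<lambda>j. x j - u j)) / b * b"
    using b by (intro ennreal_divide_mult_cancel[symmetric]) auto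
  also have "\<dots> \<le> HL_max d g x * b"
    unfolding HL_max_def b_def by (intro mult_right_mono SUP_upper) auto
  finally show ?thesis by (simp only: mult.commute[of b] b_def[symmetric])
qed

text \<open>
  The powers of \<open>n\<close> balance: the sphere sum contributes \<open>n powr (d / k - 1)\<close>, each of the \<open>l - 1\<close>
  box sums \<open>n powr (d / k)\<close>, and the number of tuples is at least \<open>c\<close> times
  \<open>n powr (l * d / k - 1)\<close>.  Since \<open>d > k\<close>, the first exponent is positive, so the smaller
  radii of the slices do no harm.
\<close>

lemma avg_max_le_prod:
  assumes k: "k \<ge> 1" and dk: "d > k" and j: "j < l" and c: "c > 0"
    and N1: "\<And>n. n \<ge> 1 \<Longrightarrow> N_sphere d k 1 n > 0 \<Longrightarrow>
      real (N_sphere d k 1 n) \<le> C * real n powr (real d / real k - 1)"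
    and Nl: "\<And>n. n \<ge> 1 \<Longrightarrow> N_sphere d k l n > 0 \<Longrightarrow>
      c * real n powr (real l * real d / real k - 1) \<le> real (N_sphere d k l n)"
  shows "avg_max d k l g x \<le> ennreal (max C 1 * (3 ^ d) ^ (l - 1) / c) *
    (\<Prod>i<l. if i = j then sphere_max d k (g i) x else HL_max d (g i) x)"
  unfolding avg_max_def
proof (rule SUP_least)
  fix n :: nat
  assume "n \<in> {n. 1 \<le> n \<and> 0 < N_sphere d k l n}"
  then have n: "n \<ge> 1" and Npos: "N_sphere d k l n > 0" by auto
  define I where "I = {..<l} - {j}"
  have I: "finite I" "j \<notin> I" "{..<l} = insert j I" "card I = l - 1" using j by (auto simp: I_def)
  define a where "a = real d / real k"
  have a: "a \<ge> 1" using dk k by (simp add: a_def)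
  \<comment> \<open>The smallest box that contains all vectors with \<open>kpow d k w \<le> n\<close>.\<close>
  define R where "R = nat \<lfloor>root k (real n)\<rfloor>"
  \<comment> \<open>The maximum with \<open>1\<close> covers the sphere of radius \<open>0\<close>, which has one point.\<close>
  define A where "A = max C 1 * real n powr (a - 1)"
  define D where "D = 3 ^ d * real n powr a"
  have A: "A \<ge> 0" by (simp add: A_def)
  have D: "D \<ge> 0" by (simp add: D_def)
  have card_sph: "real (card (int_sphere d k z)) \<le> A" if z: "z \<le> int n" for z
  proof (cases "int_sphere d k z = {}")
    case False
    then have "z \<ge> 0" using kpow_nonneg by (auto simp: int_sphere_def)
    have n1: "real n powr (a - 1) \<ge> 1" using n a by (intro ge_one_powr_ge_zero) auto
    show ?thesis
    proof (cases "z = 0")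
      case True
      have "1 * 1 \<le> A" unfolding A_def using n1 by (intro mult_mono) auto
      then show ?thesis using True k by (simp add: int_sphere_0)
    next
      case False
      define m where "m = nat z"
      have m: "z = int m" "m \<ge> 1" "m \<le> n" using False \<open>z \<ge> 0\<close> z by (auto simp: m_def)
      have "N_sphere d k 1 m > 0"
        unfolding N_sphere_1 using \<open>int_sphere d k z \<noteq> {}\<close> finite_int_sphere[OF k] m(1) by (simp add: card_gt_0_iff)
      then have "real (card (int_sphere d k z)) \<le> C * real m powr (a - 1)"
        unfolding m(1) a_def using N1[OF m(2)] N_sphere_1[of d k m] by simp
      also have "\<dots> \<le> max C 1 * real n powr (a - 1)"
        using m a by (intro mult_mono powr_mono2) auto
      finally show ?thesis by (simp add: A_def)
    qed
  qed (simp add: A)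
  have boxR: "(2 * real R + 1) ^ d \<le> D"
  proof -
    have root: "root k (real n) = real n powr (1 / real k)"
      using k n by (simp add: root_powr_inverse)
    have root_ge: "root k (real n) \<ge> 1" using k n by simp
    have "real R \<le> root k (real n)" using root_ge by (simp add: R_def)
    then have "2 * real R + 1 \<le> 3 * root k (real n)" using root_ge by linarith
    then have "(2 * real R + 1) ^ d \<le> (3 * root k (real n)) ^ d" by (intro power_mono) auto
    also have "\<dots> = 3 ^ d * (real n powr (1 / real k)) ^ d" by (simp only: power_mult_distrib root)
    also have "(real n powr (1 / real k)) ^ d = real n powr a"
      using n by (simp add: a_def powr_powr flip: powr_realpow)
    finally show ?thesis by (simp add: D_def)
  qed
  have "(\<Sum>u\<in>sphere_tuples d k l n. \<Prod>i<l. g i (\<lambda>j. x j - u i j))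
      \<le> (ennreal A * sphere_max d k (g j) x) * (\<Prod>i\<in>{..<l} - {j}. \<Sum>w\<in>int_box d R. g i (\<lambda>j. x j - w j))"
  proof (rule sum_sphere_tuples_le[OF k j])
    show "w \<in> int_box d R" if "w \<in> Zd d" "kpow d k w \<le> int n" for w
      unfolding R_def using k that by (rule mem_box_if_kpow_le)
    show "(\<Sum>w\<in>int_sphere d k z. g j (\<lambda>j. x j - w j)) \<le> ennreal A * sphere_max d k (g j) x"
      if "z \<le> int n" for z
    proof -
      have "of_nat (card (int_sphere d k z)) \<le> ennreal A"
        unfolding ennreal_of_nat_eq_real_of_nat using card_sph[OF that] by (rule ennreal_leI)
      then show ?thesis
        by (intro order_trans[OF sum_int_sphere_le_sphere_max[OF k]] mult_right_mono) auto
    qed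
  qed
  also have "\<dots> \<le> (ennreal A * sphere_max d k (g j) x) * (\<Prod>i\<in>I. ennreal D * HL_max d (g i) x)"
    unfolding I_def using boxR
    by (intro mult_left_mono prod_mono_ennreal order_trans[OF sum_box_le_HL_max] mult_right_mono ennreal_leI) auto
  also have "\<dots> = ennreal (A * D ^ (l - 1)) * (sphere_max d k (g j) x * (\<Prod>i\<in>I. HL_max d (g i) x))"
    using A D I(4) by (simp add: prod.distrib ennreal_mult ennreal_power mult_ac)
  also have "sphere_max d k (g j) x * (\<Prod>i\<in>I. HL_max d (g i) x)
      = (\<Prod>i<l. if i = j then sphere_max d k (g i) x else HL_max d (g i) x)" (is "_ = ?P")
    using I(1,2) unfolding I(3) by (subst prod.insert) (auto intro!: arg_cong2[where f = "(*)"] prod.cong)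
  finally have le: "(\<Sum>u\<in>sphere_tuples d k l n. \<Prod>i<l. g i (\<lambda>j. x j - u i j)) \<le> ennreal (A * D ^ (l - 1)) * ?P" .
  have l: "real (l - 1) = real l - 1" using j by (simp add: of_nat_diff)
  have "(real n powr a) ^ (l - 1) = real n powr (a * (real l - 1))"
    using n powr_realpow[of "real n powr a" "l - 1"] by (simp only: powr_powr l) simp
  then have "D ^ (l - 1) = (3 ^ d) ^ (l - 1) * real n powr (a * (real l - 1))"
    by (simp only: D_def power_mult_distrib)
  then have "A * D ^ (l - 1) = max C 1 * (3 ^ d) ^ (l - 1) * (real n powr (a - 1) * real n powr (a * (real l - 1)))"
    by (simp add: A_def)
  also have "real n powr (a - 1) * real n powr (a * (real l - 1)) = real n powr (real l * real d / real k - 1)"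
  proof -
    have "a - 1 + a * (real l - 1) = real l * a - 1" by (simp add: algebra_simps)
    then show ?thesis by (simp only: powr_add[symmetric] a_def times_divide_eq_right)
  qed
  also have "max C 1 * (3 ^ d) ^ (l - 1) * real n powr (real l * real d / real k - 1)
      = max C 1 * (3 ^ d) ^ (l - 1) / c * (c * real n powr (real l * real d / real k - 1))"
    using c by simp
  also have "\<dots> \<le> max C 1 * (3 ^ d) ^ (l - 1) / c * real (N_sphere d k l n)"
    using c Nl[OF n Npos] by (intro mult_left_mono) auto
  finally have "ennreal (A * D ^ (l - 1)) \<le> ennreal (max C 1 * (3 ^ d) ^ (l - 1) / c * real (N_sphere d k l n))"
    by (rule ennreal_leI)
  also have "\<dots> = ennreal (max C 1 * (3 ^ d) ^ (l - 1) / c) * of_nat (N_sphere d k l n)"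
    using c by (subst ennreal_mult) (auto simp: ennreal_of_nat_eq_real_of_nat le_max_iff_disj)
  finally have "ennreal (A * D ^ (l - 1)) * ?P
      \<le> ennreal (max C 1 * (3 ^ d) ^ (l - 1) / c) * of_nat (N_sphere d k l n) * ?P"
    by (rule mult_right_mono) simp
  with le have "(\<Sum>u\<in>sphere_tuples d k l n. \<Prod>i<l. g i (\<lambda>j. x j - u i j))
      \<le> ennreal (max C 1 * (3 ^ d) ^ (l - 1) / c) * ?P * of_nat (N_sphere d k l n)"
    by (simp only: mult_ac)
  then have "(\<Sum>u\<in>sphere_tuples d k l n. \<Prod>i<l. g i (\<lambda>j. x j - u i j)) / of_nat (N_sphere d k l n)
      \<le> ennreal (max C 1 * (3 ^ d) ^ (l - 1) / c) * ?P * of_nat (N_sphere d k l n) / of_nat (N_sphere d k l n)"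
    by (rule divide_right_mono_ennreal)
  also have "\<dots> = ennreal (max C 1 * (3 ^ d) ^ (l - 1) / c) * ?P"
    using Npos by (intro ennreal_mult_divide_eq) auto
  finally show "(\<Sum>u\<in>sphere_tuples d k l n. \<Prod>i<l. g i (\<lambda>j. x j - u i j)) / of_nat (N_sphere d k l n)
      \<le> ennreal (max C 1 * (3 ^ d) ^ (l - 1) / c) * ?P" .
qed

section \<open>Bounds at admissible exponents and interpolation between them\<close>

text \<open>
  The target exponent is tied to the \<open>c i\<close> by the Hoelder relation; larger target exponents are
  reached by nesting of the \<open>l\<^sup>p\<close> spaces.
\<close>

definition avg_bounded :: "nat \<Rightarrow> nat \<Rightarrow> nat \<Rightarrow> (nat \<Rightarrow> real) \<Rightarrow> bool" where
  "avg_bounded d k l c \<longleftrightarrow> (\<exists>K>0. \<forall>g.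
     recip_norm (\<Sum>i<l. c i) (Zd d) (avg_max d k l g)
       \<le> ennreal K * (\<Prod>i<l. recip_norm (c i) (Zd d) (g i)))"

text \<open>
  The pointwise bound by a product combined with Hoelder's inequality: only the variable \<open>j\<close> has to
  meet the restriction of the linear spherical operator, the others merely need exponents above \<open>1\<close>.
\<close>

lemma avg_bounded_if_one_linear:
  assumes j: "j < l" and c: "\<And>i. i < l \<Longrightarrow> 0 \<le> c i \<and> c i < 1"
    and sph: "\<exists>K>0. \<forall>g. recip_norm (c j) (Zd d) (sphere_max d k g) \<le> ennreal K * recip_norm (c j) (Zd d) g"
    and A: "A > 0" "\<And>g x. avg_max d k l g x \<le> ennreal A *
      (\<Prod>i<l. if i = j then sphere_max d k (g i) x else HL_max d (g i) x)"
  shows "avg_bounded d k l c"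
proof -
  define M where "M i h = (if i = j then sphere_max d k h else HL_max d h)" for i h
  have "\<exists>K>0. \<forall>g. recip_norm (c i) (Zd d) (M i g) \<le> ennreal K * recip_norm (c i) (Zd d) g"
    if "i < l" for i
  proof (cases "i = j")
    case True
    then show ?thesis using sph by (simp add: M_def)
  next
    case False
    then show ?thesis using c[OF that] HL_max_bounded[of "c i" d] by (simp add: M_def)
  qed
  then obtain K where K: "\<And>i. i < l \<Longrightarrow> K i > 0"
    and bd: "\<And>i g. i < l \<Longrightarrow> recip_norm (c i) (Zd d) (M i g) \<le> ennreal (K i) * recip_norm (c i) (Zd d) g"
    by metis
  have s: "(\<Sum>i<l. c i) \<ge> 0" using c by (intro sum_nonneg) auto
  have "recip_norm (\<Sum>i<l. c i) (Zd d) (avg_max d k l g)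
      \<le> ennreal (A * (\<Prod>i<l. K i)) * (\<Prod>i<l. recip_norm (c i) (Zd d) (g i))" for g
  proof -
    have "recip_norm (\<Sum>i<l. c i) (Zd d) (avg_max d k l g)
        \<le> recip_norm (\<Sum>i<l. c i) (Zd d) (\<lambda>x. ennreal A * (\<Prod>i<l. M i (g i) x))"
      using s
    proof (rule recip_norm_mono)
      fix x
      have "(\<Prod>i<l. M i (g i) x) = (\<Prod>i<l. if i = j then sphere_max d k (g i) x else HL_max d (g i) x)"
        by (intro prod.cong) (auto simp: M_def)
      then show "avg_max d k l g x \<le> ennreal A * (\<Prod>i<l. M i (g i) x)" using A(2) by simp
    qed
    also have "\<dots> = ennreal A * recip_norm (\<Sum>i<l. c i) (Zd d) (\<lambda>x. \<Prod>i<l. M i (g i) x)"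
      using s by (rule recip_norm_cmult)
    also have "\<dots> \<le> ennreal A * (\<Prod>i<l. recip_norm (c i) (Zd d) (M i (g i)))"
      using c by (intro mult_left_mono recip_norm_Holder) auto
    also have "\<dots> \<le> ennreal A * (\<Prod>i<l. ennreal (K i) * recip_norm (c i) (Zd d) (g i))"
      using bd by (intro mult_left_mono prod_mono_ennreal) auto
    also have "\<dots> = ennreal (A * (\<Prod>i<l. K i)) * (\<Prod>i<l. recip_norm (c i) (Zd d) (g i))"
    proof -
      have "(\<Prod>i<l. ennreal (K i)) = ennreal (\<Prod>i<l. K i)"
        using K by (intro prod_ennreal) (simp add: less_imp_le)
      moreover have "(\<Prod>i<l. K i) \<ge> 0" using K by (intro prod_nonneg) (simp add: less_imp_le)
      ultimately show ?thesis
        using A(1) by (simp add: prod.distrib ennreal_mult mult.assoc)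
    qed
    finally show ?thesis .
  qed
  moreover have "A * (\<Prod>i<l. K i) > 0" using A K by (intro mult_pos_pos prod_pos) auto
  ultimately show ?thesis unfolding avg_bounded_def by blast
qed

text \<open>
  If the exponents \<open>e j i * \<theta> j\<close> sum to \<open>1\<close> over \<open>j\<close> for each \<open>i\<close>, every product of values of the \<open>g i\<close>
  splits into weighted powers of products, and Hoelder's inequality for the sum over the sphere
  moves the weights outside the average.  Positivity of the kernel is essential here.
\<close>

lemma avg_max_le_geometric_mean:
  fixes g :: "nat \<Rightarrow> (nat \<Rightarrow> int) \<Rightarrow> ennreal"
  assumes J: "finite J" "J \<noteq> {}" and \<theta>: "\<And>j. j \<in> J \<Longrightarrow> \<theta> j > 0" "(\<Sum>j\<in>J. \<theta> j) = 1"
    and e: "\<And>i. i < l \<Longrightarrow> (\<Sum>j\<in>J. e j i * \<theta> j) = 1"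
  shows "avg_max d k l g x
    \<le> (\<Prod>j\<in>J. epowr (avg_max d k l (\<lambda>i y. epowr (g i y) (e j i)) x) (\<theta> j))"
  unfolding avg_max_def[of d k l g]
proof (rule SUP_least)
  fix n :: nat
  assume n: "n \<in> {n. 1 \<le> n \<and> 0 < N_sphere d k l n}"
  define S where "S = sphere_tuples d k l n"
  define N where "N = N_sphere d k l n"
  have N: "N > 0" using n by (simp add: N_def)
  have finS: "finite S" using n by (auto simp: S_def N_sphere_def card_gt_0_iff)
  define F where "F j u = (\<Prod>i<l. epowr (g i (\<lambda>j. x j - u i j)) (e j i))" for j u
  have "(\<Sum>u\<in>S. \<Prod>i<l. g i (\<lambda>j. x j - u i j)) = (\<Sum>u\<in>S. \<Prod>j\<in>J. epowr (F j u) (\<theta> j))"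
  proof (rule sum.cong)
    fix u
    have "(\<Prod>i<l. g i (\<lambda>j. x j - u i j)) = (\<Prod>i<l. epowr (g i (\<lambda>j. x j - u i j)) (\<Sum>j\<in>J. e j i * \<theta> j))"
      using e by (intro prod.cong) auto
    also have "\<dots> = (\<Prod>i<l. \<Prod>j\<in>J. epowr (epowr (g i (\<lambda>j. x j - u i j)) (e j i)) (\<theta> j))"
      using J by (simp add: epowr_sum epowr_epowr)
    also have "\<dots> = (\<Prod>j\<in>J. \<Prod>i<l. epowr (epowr (g i (\<lambda>j. x j - u i j)) (e j i)) (\<theta> j))"
      by (rule prod.swap)
    also have "\<dots> = (\<Prod>j\<in>J. epowr (F j u) (\<theta> j))"
      by (simp add: F_def epowr_prod)
    finally show "(\<Prod>i<l. g i (\<lambda>j. x j - u i j)) = (\<Prod>j\<in>J. epowr (F j u) (\<theta> j))" .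
  qed simp
  also have "\<dots> \<le> (\<Prod>j\<in>J. epowr (\<Sum>u\<in>S. F j u) (\<theta> j))"
    using J \<theta> finS by (rule sum_Holder)
  finally have "(\<Sum>u\<in>S. \<Prod>i<l. g i (\<lambda>j. x j - u i j)) / of_nat N
      \<le> (\<Prod>j\<in>J. epowr (\<Sum>u\<in>S. F j u) (\<theta> j)) / of_nat N"
    by (rule divide_right_mono_ennreal)
  also have "\<dots> = (\<Prod>j\<in>J. epowr ((\<Sum>u\<in>S. F j u) / of_nat N) (\<theta> j))"
  proof -
    define c where "c = inverse (of_nat N :: ennreal)"
    have "c = epowr c (\<Sum>j\<in>J. \<theta> j)" using \<theta> by simp
    also have "\<dots> = (\<Prod>j\<in>J. epowr c (\<theta> j))" using J by (rule epowr_sum)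
    finally have "(\<Prod>j\<in>J. epowr (\<Sum>u\<in>S. F j u) (\<theta> j)) * c
        = (\<Prod>j\<in>J. epowr (\<Sum>u\<in>S. F j u) (\<theta> j)) * (\<Prod>j\<in>J. epowr c (\<theta> j))" by (rule arg_cong)
    then show ?thesis by (simp add: divide_ennreal_def c_def[symmetric] epowr_mult prod.distrib)
  qed
  also have "\<dots> \<le> (\<Prod>j\<in>J. epowr (avg_max d k l (\<lambda>i y. epowr (g i y) (e j i)) x) (\<theta> j))"
    unfolding avg_max_def using n \<theta>
    by (intro prod_mono_ennreal epowr_mono SUP_upper2[of n]) (auto simp: F_def S_def N_def less_imp_le)
  finally show "(\<Sum>u\<in>sphere_tuples d k l n. \<Prod>i<l. g i (\<lambda>j. x j - u i j)) / of_nat (N_sphere d k l n)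
    \<le> (\<Prod>j\<in>J. epowr (avg_max d k l (\<lambda>i y. epowr (g i y) (e j i)) x) (\<theta> j))"
    by (simp add: S_def N_def)
qed

text \<open>
  With \<open>e j i = c j i / b i\<close> the preceding geometric mean reduces the claim to the bounds at the
  points \<open>c j\<close>: the norm of a power of \<open>g i\<close> with reciprocal exponent \<open>c j i\<close> is the power of its norm
  with reciprocal exponent \<open>b i\<close>, and for each \<open>i\<close> these powers multiply to the first power.  This
  replaces complex interpolation and works for quasi-norms on the target as well.
\<close>

theorem avg_bounded_interpolation:
  assumes J: "finite J" "J \<noteq> {}" and l: "l \<ge> 1"
    and \<theta>: "\<And>j. j \<in> J \<Longrightarrow> \<theta> j > 0" "(\<Sum>j\<in>J. \<theta> j) = 1"
    and c: "\<And>j i. j \<in> J \<Longrightarrow> i < l \<Longrightarrow> c j i > 0"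
    and b: "\<And>i. i < l \<Longrightarrow> b i = (\<Sum>j\<in>J. \<theta> j * c j i)"
    and bd: "\<And>j. j \<in> J \<Longrightarrow> avg_bounded d k l (c j)"
  shows "avg_bounded d k l b"
proof -
  obtain K where K: "\<And>j. j \<in> J \<Longrightarrow> K j > 0"
    and Kbd: "\<And>j g. j \<in> J \<Longrightarrow> recip_norm (\<Sum>i<l. c j i) (Zd d) (avg_max d k l g)
       \<le> ennreal (K j) * (\<Prod>i<l. recip_norm (c j i) (Zd d) (g i))"
    using bd unfolding avg_bounded_def by metis
  have b0: "b i > 0" if "i < l" for i
    unfolding b[OF that] using J \<theta> c that by (intro sum_pos mult_pos_pos) auto
  have s: "(\<Sum>i<l. c j i) > 0" if "j \<in> J" for j
    using l c that by (intro sum_pos) (auto simp: lessThan_empty_iff)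
  have sb: "(\<Sum>i<l. b i) = (\<Sum>j\<in>J. \<theta> j * (\<Sum>i<l. c j i))"
  proof -
    have "(\<Sum>i<l. b i) = (\<Sum>i<l. \<Sum>j\<in>J. \<theta> j * c j i)" using b by (intro sum.cong) auto
    then show ?thesis by (subst (asm) sum.swap) (simp add: sum_distrib_left)
  qed
  have sb0: "(\<Sum>i<l. b i) > 0" using l b0 by (intro sum_pos) (auto simp: lessThan_empty_iff)
  have e: "(\<Sum>j\<in>J. c j i / b i * \<theta> j) = 1" if "i < l" for i
  proof -
    have "(\<Sum>j\<in>J. c j i / b i * \<theta> j) = (\<Sum>j\<in>J. \<theta> j * c j i) / b i"
      unfolding sum_divide_distrib by (intro sum.cong) (simp_all add: mult.commute)
    also have "\<dots> = 1" using b0[OF that] b[OF that] by simp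
    finally show ?thesis .
  qed
  have "recip_norm (\<Sum>i<l. b i) (Zd d) (avg_max d k l g)
      \<le> ennreal (\<Prod>j\<in>J. K j powr \<theta> j) * (\<Prod>i<l. recip_norm (b i) (Zd d) (g i))" for g
  proof -
    define A where "A j = avg_max d k l (\<lambda>i y. epowr (g i y) (c j i / b i))" for j
    define G where "G i = recip_norm (b i) (Zd d) (g i)" for i
    have A: "recip_norm (\<Sum>i<l. c j i) (Zd d) (A j) \<le> ennreal (K j) * (\<Prod>i<l. epowr (G i) (c j i / b i))"
      if j: "j \<in> J" for j
    proof -
      have "recip_norm (c j i) (Zd d) (\<lambda>y. epowr (g i y) (c j i / b i)) = epowr (G i) (c j i / b i)"
        if "i < l" for i
        using recip_norm_epowr[of "c j i / b i" "b i" "Zd d" "g i"] c[OF j that] b0[OF that]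
        by (simp add: G_def)
      then have "(\<Prod>i<l. recip_norm (c j i) (Zd d) (\<lambda>y. epowr (g i y) (c j i / b i)))
          = (\<Prod>i<l. epowr (G i) (c j i / b i))" by (intro prod.cong) auto
      then show ?thesis using Kbd[OF j, of "\<lambda>i y. epowr (g i y) (c j i / b i)"] by (simp add: A_def)
    qed
    have "recip_norm (\<Sum>i<l. b i) (Zd d) (avg_max d k l g)
        \<le> recip_norm (\<Sum>i<l. b i) (Zd d) (\<lambda>x. \<Prod>j\<in>J. epowr (A j x) (\<theta> j))"
      unfolding A_def using sb0 J \<theta> e by (intro recip_norm_mono avg_max_le_geometric_mean) auto
    also have "\<dots> \<le> (\<Prod>j\<in>J. recip_norm (\<theta> j * (\<Sum>i<l. c j i)) (Zd d) (\<lambda>x. epowr (A j x) (\<theta> j)))"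
      unfolding sb using J \<theta> s by (intro recip_norm_Holder) (auto simp: less_imp_le)
    also have "\<dots> = (\<Prod>j\<in>J. epowr (recip_norm (\<Sum>i<l. c j i) (Zd d) (A j)) (\<theta> j))"
      using \<theta> s by (intro prod.cong recip_norm_epowr) auto
    also have "\<dots> \<le> (\<Prod>j\<in>J. epowr (ennreal (K j) * (\<Prod>i<l. epowr (G i) (c j i / b i))) (\<theta> j))"
      using \<theta> A by (intro prod_mono_ennreal epowr_mono) (auto simp: less_imp_le)
    also have "\<dots> = (\<Prod>j\<in>J. ennreal (K j powr \<theta> j)) * (\<Prod>j\<in>J. \<Prod>i<l. epowr (G i) (c j i / b i * \<theta> j))"
      unfolding prod.distrib[symmetric] using K
      by (intro prod.cong) (auto simp: epowr_mult epowr_prod epowr_epowr epowr_ennreal less_imp_le)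
    also have "(\<Prod>j\<in>J. \<Prod>i<l. epowr (G i) (c j i / b i * \<theta> j)) = (\<Prod>i<l. \<Prod>j\<in>J. epowr (G i) (c j i / b i * \<theta> j))"
      by (rule prod.swap)
    also have "\<dots> = (\<Prod>i<l. G i)"
    proof (rule prod.cong)
      fix i assume "i \<in> {..<l}"
      then have "i < l" by simp
      have "(\<Prod>j\<in>J. epowr (G i) (c j i / b i * \<theta> j)) = epowr (G i) (\<Sum>j\<in>J. c j i / b i * \<theta> j)"
        using J by (rule epowr_sum[symmetric])
      then show "(\<Prod>j\<in>J. epowr (G i) (c j i / b i * \<theta> j)) = G i" by (simp only: e[OF \<open>i < l\<close>] epowr_one)
    qed simp
    also have "(\<Prod>j\<in>J. ennreal (K j powr \<theta> j)) = ennreal (\<Prod>j\<in>J. K j powr \<theta> j)"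
      by (intro prod_ennreal) auto
    finally show ?thesis by (simp add: G_def)
  qed
  moreover have "(\<Prod>j\<in>J. K j powr \<theta> j) > 0" using K by (intro prod_pos) fastforce
  ultimately show ?thesis unfolding avg_bounded_def by blast
qed

text \<open>
  In the coordinates \<open>x i = 1 - b i\<close> with sum \<open>S > 1 - \<beta>\<close>, the point \<open>x\<close> is the combination with
  weights \<open>x j / S\<close> of the multiples \<open>S e\<^sub>j\<close> of the unit vectors.  These are not admissible, as
  coordinates have to lie strictly between \<open>0\<close> and \<open>1\<close>, so \<open>S\<close> is lowered to some \<open>y\<close> between
  \<open>1 - \<beta>\<close> and \<open>1\<close>, which keeps \<open>c j j = 1 - y\<close> below \<open>\<beta>\<close>, and the loss is made up by raising coordinate \<open>i\<close> of all the other points from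
  \<open>0\<close> to \<open>z i\<close>.
\<close>

lemma convex_combination_of_admissible:
  fixes b :: "nat \<Rightarrow> real"
  assumes \<beta>: "0 < \<beta>" "\<beta> < 1" and b: "\<And>i. i < l \<Longrightarrow> \<beta> \<le> b i \<and> b i < 1"
    and s: "(\<Sum>i<l. b i) < real l - 1 + \<beta>"
  obtains \<theta> :: "nat \<Rightarrow> real" and c :: "nat \<Rightarrow> nat \<Rightarrow> real" where
    "\<And>j. j < l \<Longrightarrow> \<theta> j > 0" "(\<Sum>j<l. \<theta> j) = 1"
    "\<And>j i. j < l \<Longrightarrow> i < l \<Longrightarrow> 0 < c j i \<and> c j i < 1" "\<And>j. j < l \<Longrightarrow> c j j < \<beta>"
    "\<And>i. i < l \<Longrightarrow> b i = (\<Sum>j<l. \<theta> j * c j i)"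
proof -
  define x where "x i = 1 - b i" for i
  define S where "S = (\<Sum>i<l. x i)"
  have S: "S > 1 - \<beta>" using s by (simp add: S_def x_def sum_subtractf)
  obtain y where y: "1 - \<beta> < y" "y < 1" "y < S"
    using dense[of "1 - \<beta>" "min 1 S"] S \<beta> by auto
  have x: "0 < x i" "x i < y" if "i < l" for i using b[OF that] y by (auto simp: x_def)
  define z where "z i = x i * (S - y) / (S - x i)" for i
  have z: "0 < z i" "z i < 1" if "i < l" for i
  proof -
    show "0 < z i" using x[OF that] y by (simp add: z_def)
    have "x i * (S - y) < 1 * (S - x i)"
      using x[OF that] y by (intro mult_strict_mono) auto
    then show "z i < 1" using x[OF that] y by (simp add: z_def divide_less_eq)
  qed
  define \<theta> where "\<theta> j = x j / S" for j
  define c where "c j i = (if i = j then 1 - y else 1 - z i)" for i j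
  have S0: "S > 0" using S \<beta> by simp
  have \<theta>1: "(\<Sum>j<l. \<theta> j) = 1" using S0 by (simp add: \<theta>_def S_def flip: sum_divide_distrib)
  have comb: "b i = (\<Sum>j<l. \<theta> j * c j i)" if "i < l" for i
  proof -
    have "(\<Sum>j<l. \<theta> j * c j i) = \<theta> i * (1 - y) + (\<Sum>j\<in>{..<l} - {i}. \<theta> j * c j i)"
      using that by (subst sum.remove[of _ i]) (auto simp: c_def)
    also have "(\<Sum>j\<in>{..<l} - {i}. \<theta> j * c j i) = (\<Sum>j\<in>{..<l} - {i}. \<theta> j) * (1 - z i)"
      unfolding sum_distrib_right by (intro sum.cong) (auto simp: c_def)
    also have "(\<Sum>j\<in>{..<l} - {i}. \<theta> j) = 1 - \<theta> i"
      using that \<theta>1 by (simp add: sum_diff1)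
    also have "1 - \<theta> i = (S - x i) / S" using S0 by (simp add: \<theta>_def diff_divide_distrib)
    also have "(S - x i) / S * (1 - z i) = (S - x i) / S - x i * (S - y) / S"
    proof -
      have "q / S * (1 - p / q) = q / S - p / S" if "q \<noteq> 0" for p q :: real
        using that S0 by (simp add: field_simps)
      from this[of "S - x i" "x i * (S - y)"] show ?thesis
        using x[OF that] y by (simp add: z_def)
    qed
    also have "\<theta> i * (1 - y) + \<dots> = b i"
      using S0 by (simp add: \<theta>_def x_def field_simps)
    finally show ?thesis by simp
  qed
  show ?thesis
  proof (rule that[of \<theta> c])
    show "\<theta> j > 0" if "j < l" for j using x[OF that] S0 by (simp add: \<theta>_def)
    show "(\<Sum>j<l. \<theta> j) = 1" by (rule \<theta>1)
    show "0 < c j i \<and> c j i < 1" if "j < l" "i < l" for j i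
      using z[OF that(2)] y \<beta> by (simp add: c_def)
    show "c j j < \<beta>" if "j < l" for j using y by (simp add: c_def)
    show "b i = (\<Sum>j<l. \<theta> j * c j i)" if "i < l" for i using that by (rule comb)
  qed
qed

section \<open>Passing between complex and nonnegative functions\<close>

lemma T_max_le_avg_max: "T_max d k m f x \<le> avg_max d k m (\<lambda>i y. ennreal (cmod (f i y))) x"
  unfolding T_max_def
proof (rule SUP_least)
  fix n assume n: "n \<in> {n. 1 \<le> n \<and> 0 < N_sphere d k m n}"
  define N where "N = N_sphere d k m n"
  have N: "N > 0" using n by (simp add: N_def)
  define s where "s = (\<Sum>u\<in>sphere_tuples d k m n. \<Prod>i<m. cmod (f i (\<lambda>j. x j - u i j)))"
  have s0: "s \<ge> 0" unfolding s_def by (intro sum_nonneg prod_nonneg) auto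
  have "cmod (\<Sum>u\<in>sphere_tuples d k m n. \<Prod>i<m. f i (\<lambda>j. x j - u i j)) \<le> s"
    unfolding s_def prod_norm by (rule norm_sum)
  then have "T_avg d k m n f x \<le> s / real N"
    using N unfolding T_avg_def N_def[symmetric]
    by (simp add: norm_mult norm_divide divide_right_mono)
  then have "ennreal (T_avg d k m n f x) \<le> ennreal (s / real N)" by (rule ennreal_leI)
  also have "\<dots> = ennreal s / of_nat N"
    using s0 N by (simp add: divide_ennreal ennreal_of_nat_eq_real_of_nat)
  also have "ennreal s = (\<Sum>u\<in>sphere_tuples d k m n. \<Prod>i<m. ennreal (cmod (f i (\<lambda>j. x j - u i j))))"
    unfolding s_def by (simp add: prod_ennreal prod_nonneg)
  also have "\<dots> / of_nat N \<le> avg_max d k m (\<lambda>i y. ennreal (cmod (f i y))) x"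
    unfolding avg_max_def N_def using n by (rule SUP_upper)
  finally show "ennreal (T_avg d k m n f x) \<le> avg_max d k m (\<lambda>i y. ennreal (cmod (f i y))) x" .
qed

text \<open>
  The radius \<open>0\<close> contributes \<open>g x\<close>, which the linear maximal operator need not dominate.
\<close>

lemma sphere_max_le_T_max:
  assumes k: "k \<ge> 1" and x: "x \<in> Zd d" and fin: "\<And>y. y \<in> Zd d \<Longrightarrow> g y \<noteq> top"
  shows "sphere_max d k g x \<le> max (T_max d k 1 (\<lambda>_ y. complex_of_real (enn2real (g y))) x) (g x)"
  unfolding sphere_max_def
proof (rule SUP_least)
  fix z assume "z \<in> {z. int_sphere d k z \<noteq> {}}"
  then have ne: "int_sphere d k z \<noteq> {}" by simp
  then have "z \<ge> 0" using kpow_nonneg by (auto simp: int_sphere_def)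
  define f where "f = (\<lambda>(_ :: nat) y. complex_of_real (enn2real (g y)))"
  show "(\<Sum>w\<in>int_sphere d k z. g (\<lambda>j. x j - w j)) / of_nat (card (int_sphere d k z))
    \<le> max (T_max d k 1 (\<lambda>_ y. complex_of_real (enn2real (g y))) x) (g x)"
  proof (cases "z = 0")
    case True
    then show ?thesis using k by (simp add: int_sphere_0 divide_ennreal_def le_max_iff_disj)
  next
    case False
    define n where "n = nat z"
    have n: "z = int n" "n \<ge> 1" using False \<open>z \<ge> 0\<close> by (auto simp: n_def)
    define N where "N = card (int_sphere d k z)"
    have N: "N > 0" using ne finite_int_sphere[OF k] by (simp add: N_def card_gt_0_iff)
    have Nn: "N_sphere d k 1 n = N" unfolding N_sphere_1 N_def n(1) ..
    define s where "s = (\<Sum>w\<in>int_sphere d k z. enn2real (g (\<lambda>j. x j - w j)))"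
    have s0: "s \<ge> 0" unfolding s_def by (intro sum_nonneg) auto
    have "(\<Sum>u\<in>sphere_tuples d k 1 n. \<Prod>i<1. f i (\<lambda>j. x j - u i j))
        = (\<Sum>u\<in>sphere_tuples d k 1 n. complex_of_real (enn2real (g (\<lambda>j. x j - u 0 j))))"
      by (simp add: f_def)
    also have "\<dots> = (\<Sum>w\<in>int_sphere d k z. complex_of_real (enn2real (g (\<lambda>j. x j - w j))))"
      unfolding n(1) by (rule sum.reindex_bij_betw[OF bij_betw_sphere_tuples_1])
    also have "\<dots> = complex_of_real s" by (simp add: s_def)
    finally have "T_avg d k 1 n f x = cmod (complex_of_real (s / real N))"
      by (simp only: T_avg_def Nn) simp
    then have T: "T_avg d k 1 n f x = s / real N" using s0 by (simp add: norm_divide)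
    have "(\<Sum>w\<in>int_sphere d k z. g (\<lambda>j. x j - w j)) = (\<Sum>w\<in>int_sphere d k z. ennreal (enn2real (g (\<lambda>j. x j - w j))))"
    proof (rule sum.cong)
      fix w assume "w \<in> int_sphere d k z"
      then have "(\<lambda>j. x j - w j) \<in> Zd d" using x by (intro Zd_diff) (auto simp: int_sphere_def)
      then show "g (\<lambda>j. x j - w j) = ennreal (enn2real (g (\<lambda>j. x j - w j)))"
        using fin by (simp add: less_top)
    qed simp
    also have "\<dots> = ennreal s" by (simp add: s_def)
    finally have "(\<Sum>w\<in>int_sphere d k z. g (\<lambda>j. x j - w j)) / of_nat N = ennreal (s / real N)"
      using s0 N by (simp add: divide_ennreal ennreal_of_nat_eq_real_of_nat)
    also have "\<dots> = ennreal (T_avg d k 1 n f x)" by (simp only: T)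
    also have "\<dots> \<le> T_max d k 1 f x"
      unfolding T_max_def using n(2) N Nn by (intro SUP_upper) simp
    finally show ?thesis by (simp add: N_def f_def le_max_iff_disj)
  qed
qed

lemma sphere_max_bounded:
  assumes k: "k \<ge> 1" and q: "q > 0" and bd: "T_max_bounded d k 1 (\<lambda>_. q) q"
  shows "\<exists>K>0. \<forall>g. recip_norm (real_of_ereal (1 / q)) (Zd d) (sphere_max d k g)
    \<le> ennreal K * recip_norm (real_of_ereal (1 / q)) (Zd d) g"
proof -
  define c where "c = real_of_ereal (1 / q)"
  have c: "c \<ge> 0" using q by (cases q) (auto simp: c_def one_ereal_def)
  obtain C where C: "\<And>f. f 0 \<in> lp_space q (Zd d) \<Longrightarrow>
      lp_norm q (Zd d) (T_max d k 1 f) \<le> ennreal C * lp_cnorm q (Zd d) (f 0)"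
    using bd unfolding T_max_bounded_def by auto
  define K where "K = 2 powr c * max C 1"
  have K: "K > 0" by (simp add: K_def)
  have "recip_norm c (Zd d) (sphere_max d k g) \<le> ennreal K * recip_norm c (Zd d) g" for g
  proof (cases "recip_norm c (Zd d) g = top")
    case True
    then show ?thesis using K by (simp add: ennreal_mult_top ennreal_eq_0_iff)
  next
    case False
    then have fin: "g y \<noteq> top" if "y \<in> Zd d" for y
      using le_recip_norm[OF c that, of g] by (auto simp: top_unique)
    define f where "f = (\<lambda>(_ :: nat) y. complex_of_real (enn2real (g y)))"
    have norm: "lp_cnorm q (Zd d) (f 0) = recip_norm c (Zd d) g"
      unfolding lp_cnorm_def lp_norm_eq_recip_norm[OF q] c_def
      using fin by (intro recip_norm_cong) (simp add: f_def less_top)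
    then have "f 0 \<in> lp_space q (Zd d)" using False by (simp add: lp_space_def less_top)
    from C[of f, OF this] have T: "recip_norm c (Zd d) (T_max d k 1 f) \<le> ennreal C * recip_norm c (Zd d) g"
      unfolding norm lp_norm_eq_recip_norm[OF q] c_def[symmetric] .
    have "recip_norm c (Zd d) (sphere_max d k g)
        \<le> recip_norm c (Zd d) (\<lambda>x. max (T_max d k 1 f x) (g x))"
      unfolding f_def using k fin by (intro recip_norm_mono[OF c] sphere_max_le_T_max)
    also have "\<dots> \<le> ennreal (2 powr c) * max (recip_norm c (Zd d) (T_max d k 1 f)) (recip_norm c (Zd d) g)"
      using c by (rule recip_norm_max_le)
    also have "\<dots> \<le> ennreal (2 powr c) * (ennreal (max C 1) * recip_norm c (Zd d) g)"
    proof (intro mult_left_mono max.boundedI)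
      show "recip_norm c (Zd d) (T_max d k 1 f) \<le> ennreal (max C 1) * recip_norm c (Zd d) g"
        by (rule order_trans[OF T]) (intro mult_right_mono ennreal_leI, auto)
      have "1 * recip_norm c (Zd d) g \<le> ennreal (max C 1) * recip_norm c (Zd d) g"
        by (intro mult_right_mono) auto
      then show "recip_norm c (Zd d) g \<le> ennreal (max C 1) * recip_norm c (Zd d) g" by simp
    qed simp
    also have "\<dots> = ennreal K * recip_norm c (Zd d) g"
      by (simp add: K_def ennreal_mult mult.assoc)
    finally show ?thesis .
  qed
  then show ?thesis using K unfolding c_def by blast
qed

text \<open>
  The whole range is the convex hull of the points with one coordinate below \<open>\<beta>\<close>.
\<close>

lemma avg_bounded_below_critical:
  assumes \<beta>: "0 < \<beta>" "\<beta> < 1" and l: "l \<ge> 1"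
    and base: "\<And>c j. j < l \<Longrightarrow> c j < \<beta> \<Longrightarrow> (\<And>i. i < l \<Longrightarrow> 0 \<le> c i \<and> c i < 1) \<Longrightarrow> avg_bounded d k l c"
    and b: "\<And>i. i < l \<Longrightarrow> 0 \<le> b i \<and> b i < 1" and s: "(\<Sum>i<l. b i) < real l - 1 + \<beta>"
  shows "avg_bounded d k l b"
proof (cases "\<exists>j<l. b j < \<beta>")
  case True
  then obtain j where "j < l" "b j < \<beta>" by blast
  then show ?thesis by (rule base) (rule b)
next
  case False
  then have ge: "\<beta> \<le> b i \<and> b i < 1" if "i < l" for i
    using b[OF that] that by (meson not_less)
  show ?thesis
  proof (rule convex_combination_of_admissible[OF \<beta> ge s])
    fix \<theta> :: "nat \<Rightarrow> real" and c :: "nat \<Rightarrow> nat \<Rightarrow> real"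
    assume \<theta>: "\<And>j. j < l \<Longrightarrow> \<theta> j > 0" "(\<Sum>j<l. \<theta> j) = 1"
    and c: "\<And>j i. j < l \<Longrightarrow> i < l \<Longrightarrow> 0 < c j i \<and> c j i < 1" "\<And>j. j < l \<Longrightarrow> c j j < \<beta>"
    and comb: "\<And>i. i < l \<Longrightarrow> b i = (\<Sum>j<l. \<theta> j * c j i)"
    show ?thesis
  proof (rule avg_bounded_interpolation[of "{..<l}" l \<theta> c])
    show "avg_bounded d k l (c j)" if "j \<in> {..<l}" for j
    proof (rule base[of j])
      have j: "j < l" using that by simp
      then show "j < l" "c j j < \<beta>" using c(2) by auto
      show "0 \<le> c j i \<and> c j i < 1" if "i < l" for i using c(1)[OF j that] by simp
    qed
    show "{..<l} \<noteq> {}" using l by (simp add: lessThan_empty_iff)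
    show "0 < c j i" if "j \<in> {..<l}" "i < l" for j i using c(1)[of j i] that by simp
    show "(\<Sum>j<l. \<theta> j) = 1" by (rule \<theta>(2))
    show "b i = (\<Sum>j<l. \<theta> j * c j i)" if "i < l" for i using that by (rule comb)
    qed (use l \<theta>(1) in simp_all)
  qed
qed

text \<open>
  When the sum of the \<open>1 / p i\<close> exceeds \<open>1 / r\<close>, it suffices to have a bound at smaller reciprocal
  exponents \<open>b i\<close>, because the \<open>l\<^sup>p\<close> spaces over a counting measure increase with \<open>p\<close>.
\<close>

lemma T_max_bounded_if_avg_bounded:
  assumes p: "\<And>i. i < l \<Longrightarrow> p i > 0" and r: "r > 0"
    and b: "\<And>i. i < l \<Longrightarrow> 0 \<le> b i \<and> b i \<le> real_of_ereal (1 / p i)"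
    and sum: "(\<Sum>i<l. b i) = real_of_ereal (1 / r)" and bd: "avg_bounded d k l b"
  shows "T_max_bounded d k l p r"
proof -
  obtain K where K: "\<And>g. recip_norm (\<Sum>i<l. b i) (Zd d) (avg_max d k l g)
      \<le> ennreal K * (\<Prod>i<l. recip_norm (b i) (Zd d) (g i))"
    using bd unfolding avg_bounded_def by blast
  have "lp_norm r (Zd d) (T_max d k l f) \<le> ennreal K * (\<Prod>i<l. lp_cnorm (p i) (Zd d) (f i))" for f
  proof -
    define g where "g = (\<lambda>i y. ennreal (cmod (f i y)))"
    have "lp_norm r (Zd d) (T_max d k l f) = recip_norm (\<Sum>i<l. b i) (Zd d) (T_max d k l f)"
      using r by (simp only: lp_norm_eq_recip_norm sum)
    also have "\<dots> \<le> recip_norm (\<Sum>i<l. b i) (Zd d) (avg_max d k l g)"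
      unfolding g_def using b by (intro recip_norm_mono T_max_le_avg_max sum_nonneg) auto
    also have "\<dots> \<le> ennreal K * (\<Prod>i<l. recip_norm (b i) (Zd d) (g i))" by (rule K)
    also have "\<dots> \<le> ennreal K * (\<Prod>i<l. lp_cnorm (p i) (Zd d) (f i))"
    proof (intro mult_left_mono prod_mono_ennreal)
      fix i assume "i \<in> {..<l}"
      then have i: "i < l" by simp
      show "recip_norm (b i) (Zd d) (g i) \<le> lp_cnorm (p i) (Zd d) (f i)"
        unfolding lp_cnorm_def lp_norm_eq_recip_norm[OF p[OF i]] g_def
        using b[OF i] by (intro recip_norm_nested) auto
    qed simp
    finally show ?thesis .
  qed
  then show ?thesis unfolding T_max_bounded_def by blast
qed

section \<open>Necessity of the lower bound on the target exponent\<close>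

lemma finite_sphere_tuples:
  assumes k: "k \<ge> 1"
  shows "finite (sphere_tuples d k l n)"
proof (rule finite_subset)
  show "sphere_tuples d k l n \<subseteq> {..<l} \<rightarrow>\<^sub>E int_box d (nat \<lfloor>root k (real n)\<rfloor>)"
  proof
    fix u assume u: "u \<in> sphere_tuples d k l n"
    have "u i \<in> int_box d (nat \<lfloor>root k (real n)\<rfloor>)" if "i < l" for i
    proof (rule mem_box_if_kpow_le[OF k])
      show "u i \<in> Zd d" using u that by (auto simp: sphere_tuples_def)
      have "kpow d k (u i) \<le> (\<Sum>i<l. kpow d k (u i))"
        using that kpow_nonneg by (intro member_le_sum) auto
      then show "kpow d k (u i) \<le> int n" using u by (simp add: sphere_tuples_def)
    qed
    then show "u \<in> {..<l} \<rightarrow>\<^sub>E int_box d (nat \<lfloor>root k (real n)\<rfloor>)"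
      using u by (auto simp: sphere_tuples_def PiE_def)
  qed
  show "finite ({..<l} \<rightarrow>\<^sub>E int_box d (nat \<lfloor>root k (real n)\<rfloor>))"
    by (intro finite_PiE) auto
qed

definition kronecker_delta :: "(nat \<Rightarrow> int) \<Rightarrow> complex" where
  "kronecker_delta y = (if y = (\<lambda>_. 0) then 1 else 0)"

lemma lp_cnorm_delta: "p > 0 \<Longrightarrow> lp_cnorm p (Zd d) kronecker_delta \<le> 1"
proof -
  assume p: "p > 0"
  define c where "c = real_of_ereal (1 / p)"
  have z: "(\<lambda>_. 0) \<in> Zd d" by (simp add: Zd_def)
  have e1: "epowr 1 a = 1" for a using epowr_ennreal[of 1 a] by simp
  have "recip_norm c (Zd d) (\<lambda>x. ennreal (cmod (kronecker_delta x))) \<le> 1"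
  proof (cases "c = 0")
    case True
    then show ?thesis by (auto simp: recip_norm_def kronecker_delta_def intro!: SUP_least)
  next
    case False
    have "(\<integral>\<^sup>+x. epowr (ennreal (cmod (kronecker_delta x))) (1 / c) \<partial>count_space (Zd d))
        = (\<Sum>x\<in>{\<lambda>_. 0}. epowr (ennreal (cmod (kronecker_delta x))) (1 / c))"
      using z by (intro nn_integral_count_space') (auto simp: kronecker_delta_def)
    also have "\<dots> = 1" by (simp add: kronecker_delta_def e1)
    finally show ?thesis using False by (simp add: recip_norm_def e1)
  qed
  then show ?thesis by (simp add: lp_cnorm_def lp_norm_eq_recip_norm[OF p] c_def)
qed

text \<open>
  On the sphere that contains the tuple \<open>(x, ..., x)\<close>, this tuple alone contributes to the average at
  \<open>x\<close> of point masses at the origin.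
\<close>

lemma T_max_delta_ge:
  assumes k: "k \<ge> 1" and x: "x \<in> Zd d" and n: "int n = int l * kpow d k x" "n \<ge> 1"
  shows "N_sphere d k l n > 0"
    and "ennreal (1 / real (N_sphere d k l n)) \<le> T_max d k l (\<lambda>_. kronecker_delta) x"
proof -
  define v where "v = restrict (\<lambda>_. x) {..<l}"
  have v: "v \<in> sphere_tuples d k l n"
    using x n by (auto simp: v_def sphere_tuples_def)
  then show N: "N_sphere d k l n > 0"
    using finite_sphere_tuples[OF k] by (auto simp: N_sphere_def card_gt_0_iff)
  have "(\<Prod>i<l. kronecker_delta (\<lambda>j. x j - u i j)) = (if u = v then 1 else 0)"
    if u: "u \<in> sphere_tuples d k l n" for u
  proof (cases "u = v")
    case True
    then show ?thesis by (auto simp: v_def kronecker_delta_def intro!: prod.neutral)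
  next
    case False
    have "\<exists>i<l. u i \<noteq> x"
    proof (rule ccontr)
      assume "\<not> (\<exists>i<l. u i \<noteq> x)"
      then have "u = v"
        using u by (auto simp: v_def sphere_tuples_def PiE_def extensional_def fun_eq_iff)
      then show False using False by simp
    qed
    then obtain i where i: "i < l" "u i \<noteq> x" by blast
    then obtain a where "x a - u i a \<noteq> 0" by (metis eq_iff_diff_eq_0 ext)
    then have "(\<lambda>j. x j - u i j) \<noteq> (\<lambda>_. 0)" by meson
    then have "kronecker_delta (\<lambda>j. x j - u i j) = 0" by (simp add: kronecker_delta_def)
    then show ?thesis using i False by (auto intro!: prod_zero)
  qed
  then have "(\<Sum>u\<in>sphere_tuples d k l n. \<Prod>i<l. kronecker_delta (\<lambda>j. x j - u i j))
      = (\<Sum>u\<in>sphere_tuples d k l n. if u = v then 1 else 0)" by (intro sum.cong) auto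
  also have "\<dots> = 1" using v finite_sphere_tuples[OF k] by simp
  finally have "T_avg d k l n (\<lambda>_. kronecker_delta) x = 1 / real (N_sphere d k l n)"
    by (simp add: T_avg_def norm_divide)
  then have "ennreal (1 / real (N_sphere d k l n)) = ennreal (T_avg d k l n (\<lambda>_. kronecker_delta) x)" by simp
  also have "\<dots> \<le> T_max d k l (\<lambda>_. kronecker_delta) x"
    unfolding T_max_def using N n(2) by (intro SUP_upper) simp
  finally show "ennreal (1 / real (N_sphere d k l n)) \<le> T_max d k l (\<lambda>_. kronecker_delta) x" .
qed

text \<open>
  Test with point masses at the origin.  At a point of size \<open>2 ^ m\<close> the maximal function is at least
  a constant times \<open>2 powr (- m * (l * d - k))\<close>, and there are \<open>2 ^ (m * d)\<close> such points.  If
  \<open>r * (l * d - k) \<le> d\<close>, each dyadic shell contributes at least a fixed \<open>c0 > 0\<close> to the sum of the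
  \<open>r\<close>-th powers, which therefore diverges.
\<close>

lemma T_max_bounded_imp_exponent_gt:
  fixes r :: real
  assumes k: "k \<ge> 1" and l: "l \<ge> 1" and dk: "d > k" and C: "C > 0"
    and Nl: "\<And>n. n \<ge> 1 \<Longrightarrow> N_sphere d k l n > 0 \<Longrightarrow>
      real (N_sphere d k l n) \<le> C * real n powr (real l * real d / real k - 1)"
    and p: "\<And>i. i < l \<Longrightarrow> p i > 0" and r: "r > 0"
    and bd: "T_max_bounded d k l p (ereal r)"
  shows "r > real d / (real l * real d - real k)"
proof (rule ccontr)
  assume neg: "\<not> ?thesis"
  have ld: "real l * real d - real k > 0"
  proof -
    have "real k < 1 * real d" using dk by simp
    also have "\<dots> \<le> real l * real d" using l by (intro mult_right_mono) auto
    finally show ?thesis by simp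
  qed
  then have small: "(real l * real d - real k) * r \<le> real d"
    using neg by (simp add: field_simps not_less)
  define e where "e = real l * real d / real k - 1"
  have ke: "real k * e = real l * real d - real k" using k by (simp add: e_def field_simps)
  have e: "e > 0" using ke ld k by (metis mult_le_0_iff not_le of_nat_0_le_iff)
  let ?T = "T_max d k l (\<lambda>_. kronecker_delta)"
  define I where "I = (\<integral>\<^sup>+x. epowr (?T x) r \<partial>count_space (Zd d))"
  have "I < top"
  proof -
    obtain C' where C': "\<And>f. (\<forall>i<l. f i \<in> lp_space (p i) (Zd d)) \<Longrightarrow>
        lp_norm r (Zd d) (T_max d k l f) \<le> ennreal C' * (\<Prod>i<l. lp_cnorm (p i) (Zd d) (f i))"
      using bd unfolding T_max_bounded_def by blast
    have "lp_norm r (Zd d) ?T \<le> ennreal C' * (\<Prod>i<l. lp_cnorm (p i) (Zd d) kronecker_delta)"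
      using p lp_cnorm_delta[of "p _" d]
      by (intro C') (auto simp: lp_space_def intro: le_less_trans[OF _ ennreal_one_less_top])
    also have "\<dots> \<le> ennreal C' * (\<Prod>i<l. 1)"
      using p by (intro mult_left_mono prod_mono_ennreal lp_cnorm_delta) auto
    also have "\<dots> < top" by simp
    finally have "epowr I (1 / r) < top" by (simp add: lp_norm_def I_def)
    then show ?thesis unfolding less_top[symmetric] by simp
  qed
  define shell where "shell m = {u \<in> Zd d. \<forall>j<d. u j \<in> {2 ^ m..<2 ^ Suc m}}" for m :: nat
  have finite_shell: "finite (shell m)" for m
    unfolding shell_def by (rule finite_Zd_coords) simp
  have card_shell: "card (shell m) = 2 ^ (m * d)" for m
    unfolding shell_def card_Zd_coords by (simp add: power_mult nat_power_eq)
  define A where "A = real l * real d * 2 ^ k"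
  define c0 where "c0 = (C * A powr e) powr - r"
  have A: "A > 0" using l dk by (simp add: A_def)
  have c0: "c0 > 0" using C A by (simp add: c0_def)
  have T_ge: "ennreal (c0 / 2 ^ (m * d)) \<le> epowr (?T x) r" if x: "x \<in> shell m" for x m
  proof -
    have xZ: "x \<in> Zd d" and xj: "\<And>j. j < d \<Longrightarrow> 2 ^ m \<le> x j \<and> x j < 2 ^ Suc m"
      using x by (auto simp: shell_def)
    define n where "n = nat (int l * kpow d k x)"
    have n: "int n = int l * kpow d k x" using kpow_nonneg[of d k x] by (simp add: n_def)
    have "(1::int) \<le> \<bar>x 0\<bar> ^ k"
    proof -
      have "(1::int) \<le> 2 ^ m" by simp
      also have "\<dots> \<le> \<bar>x 0\<bar>" using xj[of 0] dk by auto
      finally show ?thesis by simp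
    qed
    also have "\<dots> \<le> kpow d k x" using dk by (intro abs_coord_power_le_kpow) simp
    finally have kp: "1 \<le> kpow d k x" .
    have n1: "n \<ge> 1"
    proof -
      have "1 * 1 \<le> int l * kpow d k x" using l kp by (intro mult_mono) auto
      then show ?thesis using n by linarith
    qed
    have "kpow d k x \<le> (\<Sum>j<d. (2 ^ Suc m) ^ k)"
      unfolding kpow_def
    proof (intro sum_mono power_mono)
      fix j assume "j \<in> {..<d}"
      then have "2 ^ m \<le> x j" "x j < 2 ^ Suc m" using xj by auto
      moreover have "(0::int) < 2 ^ m" by simp
      ultimately show "\<bar>x j\<bar> \<le> 2 ^ Suc m" by linarith
    qed simp
    then have "int l * kpow d k x \<le> int l * (int d * (2 ^ Suc m) ^ k)"
      by (intro mult_left_mono) auto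
    then have "real_of_int (int n) \<le> real_of_int (int l * (int d * (2 ^ Suc m) ^ k))"
      unfolding n of_int_le_iff .
    also have "\<dots> = A * 2 ^ (m * k)"
      by (simp add: A_def power_mult_distrib power_mult)
    finally have nA: "real n \<le> A * 2 ^ (m * k)" by simp
    note N = T_max_delta_ge[OF k xZ n n1]
    have "real (N_sphere d k l n) \<le> C * real n powr e"
      using Nl[OF n1 N(1)] by (simp add: e_def)
    also have "\<dots> \<le> C * (A * 2 ^ (m * k)) powr e"
      using C e nA by (intro mult_left_mono powr_mono2) auto
    also have "(A * 2 ^ (m * k)) powr e = A powr e * 2 powr (real m * (real k * e))"
      using A by (simp add: powr_mult powr_powr mult_ac flip: powr_realpow)
    finally have Nle: "real (N_sphere d k l n) \<le> C * A powr e * 2 powr (real m * (real k * e))"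
      by (simp add: mult.assoc)
    have "c0 / 2 ^ (m * d) = c0 * 2 powr - (real m * real d)"
      by (simp add: powr_minus divide_inverse flip: powr_realpow)
    also have "\<dots> \<le> c0 * 2 powr - (real m * ((real k * e) * r))"
      using c0 small by (intro mult_left_mono powr_mono) (auto simp: ke mult_left_mono)
    also have "\<dots> = (C * A powr e * 2 powr (real m * (real k * e))) powr - r"
      using C A by (simp add: c0_def powr_mult powr_powr mult_ac)
    also have "\<dots> \<le> real (N_sphere d k l n) powr - r"
      using N(1) Nle r by (intro powr_mono2') auto
    also have "\<dots> = (1 / real (N_sphere d k l n)) powr r"
      by (simp add: powr_minus powr_divide inverse_eq_divide)
    finally have "ennreal (c0 / 2 ^ (m * d)) \<le> epowr (ennreal (1 / real (N_sphere d k l n))) r"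
      by (simp add: epowr_ennreal ennreal_leI)
    also have "\<dots> \<le> epowr (?T x) r" using r N(2) by (intro epowr_mono) auto
    finally show ?thesis .
  qed
  have disj: "shell m \<inter> shell m' = {}" if "m \<noteq> m'" for m m'
  proof -
    have "shell m \<inter> shell m' = {}" if "m < m'" for m m'
    proof (rule ccontr)
      assume "shell m \<inter> shell m' \<noteq> {}"
      then obtain x where x: "x \<in> shell m" "x \<in> shell m'" by blast
      then have "x 0 < 2 ^ Suc m" "2 ^ m' \<le> x 0" using dk by (auto simp: shell_def)
      moreover have "(2::int) ^ Suc m \<le> 2 ^ m'" using that by (intro power_increasing) auto
      ultimately show False by linarith
    qed
    then show ?thesis using that by (metis Int_commute linorder_neqE_nat)
  qed
  have lower: "ennreal (real M * c0) \<le> I" for M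
  proof -
    have "ennreal (real M * c0) = (\<Sum>m<M. ennreal c0)"
      using c0 by (simp add: ennreal_mult ennreal_of_nat_eq_real_of_nat)
    also have "\<dots> = (\<Sum>m<M. \<Sum>x\<in>shell m. ennreal (c0 / 2 ^ (m * d)))"
    proof (rule sum.cong)
      fix m
      have "(\<Sum>x\<in>shell m. ennreal (c0 / 2 ^ (m * d))) = ennreal (real (2 ^ (m * d))) * ennreal (c0 / 2 ^ (m * d))"
        by (simp only: sum_constant card_shell ennreal_of_nat_eq_real_of_nat)
      also have "\<dots> = ennreal c0" using c0 by (subst ennreal_mult[symmetric]) auto
      finally show "ennreal c0 = (\<Sum>x\<in>shell m. ennreal (c0 / 2 ^ (m * d)))" ..
    qed simp
    also have "\<dots> \<le> (\<Sum>m<M. \<Sum>x\<in>shell m. epowr (?T x) r)"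
      using T_ge by (intro sum_mono) auto
    also have "\<dots> = (\<Sum>x\<in>(\<Union>m<M. shell m). epowr (?T x) r)"
      using finite_shell disj by (intro sum.UNION_disjoint[symmetric]) auto
    also have "\<dots> \<le> I"
      unfolding I_def using finite_shell by (intro sum_le_nn_integral_count_space) (auto simp: shell_def)
    finally show ?thesis .
  qed
  obtain i where i: "I = ennreal i" "i \<ge> 0" using \<open>I < top\<close> by (cases I) auto
  obtain M :: nat where "i < real M * c0" using reals_Archimedean3[OF c0] by blast
  then show False using lower[of M] i by simp
qed

theorem theorem2:
  fixes d0 :: "nat \<Rightarrow> real" and \<delta>0 :: "nat \<Rightarrow> nat \<Rightarrow> real" and k l d :: nat
  assumes k: "k \<ge> 3" and l: "l \<ge> 2"
    and d0_ge: "d0 k \<ge> real k"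
    and \<delta>0_nonneg: "\<And>d'. real d' > d0 k \<Longrightarrow> \<delta>0 d' k \<ge> 0"
    and N_asymp: "\<And>m d'. m \<ge> 1 \<Longrightarrow> real d' > d0 k / real m \<Longrightarrow>
      \<exists>c C. 0 < c \<and> c \<le> C \<and>
        (\<forall>n\<ge>1. N_sphere d' k m n > 0 \<longrightarrow>
           c * real n powr (real m * real d' / real k - 1) \<le> real (N_sphere d' k m n) \<and>
           real (N_sphere d' k m n) \<le> C * real n powr (real m * real d' / real k - 1))"
    and linear_bound: "\<And>d' q. real d' > d0 k \<Longrightarrow> ereal (p0 \<delta>0 d' k) < q \<Longrightarrow>
      T_max_bounded d' k 1 (\<lambda>_. q) q"
    and d: "real d > d0 k"
  shows "(\<forall>(p :: nat \<Rightarrow> ereal) (r :: ereal).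
            (\<forall>i<l. 1 < p i) \<and> 0 < r \<and> (\<Sum>i<l. 1 / p i) \<ge> 1 / r \<and>
            r > ereal (max (r0 \<delta>0 l d k) (real d / (real l * real d - real k)))
            \<longrightarrow> T_max_bounded d k l p r) \<and>
         (\<forall>(p :: nat \<Rightarrow> ereal) (r :: ereal).
            (\<forall>i<l. 1 < p i) \<and> 0 < r \<and> T_max_bounded d k l p r
            \<longrightarrow> r > ereal (real d / (real l * real d - real k)))"
proof -
  have k1: "k \<ge> 1" and l1: "l \<ge> 1" and dk: "d > k" using k l d d0_ge by auto
  have "d0 k / real l \<le> d0 k / 1"
    using l1 d0_ge by (intro divide_left_mono) auto
  then have dl: "real d > d0 k / real l" using d by simp
  obtain cl Cl where cl: "0 < cl" "cl \<le> Cl"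
    and Nl: "\<And>n. n \<ge> 1 \<Longrightarrow> N_sphere d k l n > 0 \<Longrightarrow>
           cl * real n powr (real l * real d / real k - 1) \<le> real (N_sphere d k l n) \<and>
           real (N_sphere d k l n) \<le> Cl * real n powr (real l * real d / real k - 1)"
    using N_asymp[OF l1 dl] by blast
  obtain C1 where N1: "\<And>n. n \<ge> 1 \<Longrightarrow> N_sphere d k 1 n > 0 \<Longrightarrow>
           real (N_sphere d k 1 n) \<le> C1 * real n powr (real d / real k - 1)"
    using N_asymp[of 1 d] d by auto
  define \<delta> where "\<delta> = \<delta>0 d k"
  have \<delta>: "\<delta> \<ge> 0" using \<delta>0_nonneg[OF d] by (simp add: \<delta>_def)
  define \<beta> where "\<beta> = 1 / p0 \<delta>0 d k"
  have p0_gt: "p0 \<delta>0 d k > 1"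
  proof -
    have "1 < real d / (real d - real k)" using dk k1 by (simp add: field_simps)
    then show ?thesis by (simp add: p0_def)
  qed
  then have \<beta>: "0 < \<beta>" "\<beta> < 1" by (auto simp: \<beta>_def)
  have ld: "real l * real d - real k > 0"
  proof -
    have "real k < 1 * real d" using dk by simp
    also have "\<dots> \<le> real l * real d" using l by (intro mult_right_mono) auto
    finally show ?thesis by simp
  qed

  \<comment> \<open>The critical value \<open>\<beta>\<close> is the reciprocal of \<open>p0\<close>: the linear bound serves every variable with
    reciprocal exponent below it.\<close>
  have base: "avg_bounded d k l c"
    if j: "j < l" and cj: "c j < \<beta>" and c: "\<And>i. i < l \<Longrightarrow> 0 \<le> c i \<and> c i < 1" for c j
  proof (rule avg_bounded_if_one_linear[OF j c])
    define q where "q = 1 / ereal (c j)"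
    have q: "q > 0" "real_of_ereal (1 / q) = c j" "ereal (p0 \<delta>0 d k) < q"
    proof -
      show "real_of_ereal (1 / q) = c j"
      proof (cases "c j = 0")
        case True
        then show ?thesis by (simp add: q_def divide_ereal_def zero_ereal_def[symmetric])
      next
        case False
        then show ?thesis by (simp add: q_def one_ereal_def)
      qed
      show *: "ereal (p0 \<delta>0 d k) < q"
      proof (cases "c j = 0")
        case True
        then show ?thesis by (simp add: q_def divide_ereal_def zero_ereal_def[symmetric])
      next
        case False
        then have "c j > 0" using c[OF j] by simp
        then have "p0 \<delta>0 d k < 1 / c j"
          using cj p0_gt by (simp add: \<beta>_def field_simps)
        then show ?thesis using False by (simp add: q_def one_ereal_def)
      qed
      have "0 < ereal (p0 \<delta>0 d k)" using p0_gt by simp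
      then show "q > 0" using * by (rule less_trans)
    qed
    show "\<exists>K>0. \<forall>g. recip_norm (c j) (Zd d) (sphere_max d k g) \<le> ennreal K * recip_norm (c j) (Zd d) g"
      using sphere_max_bounded[OF k1 q(1) linear_bound[OF d q(3)]] unfolding q(2) .
    show "max C1 1 * (3 ^ d) ^ (l - 1) / cl > 0" using cl by simp
    show "avg_max d k l g x \<le> ennreal (max C1 1 * (3 ^ d) ^ (l - 1) / cl) *
      (\<Prod>i<l. if i = j then sphere_max d k (g i) x else HL_max d (g i) x)" for g x
      using k1 dk j cl(1) N1 Nl by (intro avg_max_le_prod) auto
  qed

  show ?thesis
  proof (intro conjI allI impI)
    fix p :: "nat \<Rightarrow> ereal" and r :: ereal
    assume *: "(\<forall>i<l. 1 < p i) \<and> 0 < r \<and> (\<Sum>i<l. 1 / p i) \<ge> 1 / r \<and>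
      r > ereal (max (r0 \<delta>0 l d k) (real d / (real l * real d - real k)))"
    define a where "a i = real_of_ereal (1 / p i)" for i
    define \<rho> where "\<rho> = real_of_ereal (1 / r)"
    define s where "s = (\<Sum>i<l. a i)"
    have a: "0 \<le> a i \<and> a i < 1 \<and> 1 / p i = ereal (a i)" if "i < l" for i
    proof -
      have "1 < p i" using * that by blast
      then show ?thesis by (cases "p i") (auto simp: a_def one_ereal_def zero_ereal_def)
    qed
    have \<rho>: "0 \<le> \<rho>" "1 / r = ereal \<rho>"
      using * by (cases r; auto simp: \<rho>_def one_ereal_def zero_ereal_def)+
    have "(\<Sum>i<l. 1 / p i) = (\<Sum>i<l. ereal (a i))" using a by (intro sum.cong) auto
    then have s: "\<rho> \<le> s" using * \<rho>(2) by (simp add: s_def)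
    \<comment> \<open>The two lower bounds on \<open>r\<close> are the reciprocals of \<open>l - 1\<close> plus the reciprocals of the two
      terms whose maximum is \<open>p0\<close>.\<close>
    have \<rho>_less: "\<rho> < real l - 1 + \<beta>"
    proof (cases r)
      case (real r')
      have r': "r' > 0" "r' > r0 \<delta>0 l d k" "r' > real d / (real l * real d - real k)"
        using * real by auto
      have eq: "\<rho> = 1 / r'" using real r' by (simp add: \<rho>_def one_ereal_def)
      have "1 / r' < (real l * real d - real k) / real d"
        using r' ld dk by (simp add: field_simps)
      also have "\<dots> = real l - 1 + 1 / (real d / (real d - real k))"
        using dk by (simp add: field_simps)
      finally have 1: "\<rho> < real l - 1 + 1 / (real d / (real d - real k))" by (simp only: eq)
      define D where "D = (real l - 1) * (2 + 2 * \<delta>) + (1 + 2 * \<delta>)"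
      have "D > 0" using \<delta> l by (simp add: D_def add_nonneg_pos)
      moreover have "(2 + 2 * \<delta>) / D < r'" using r'(2) by (simp only: r0_def \<delta>_def D_def)
      ultimately have "1 / r' < D / (2 + 2 * \<delta>)"
        using r'(1) \<delta> by (simp add: field_simps)
      also have "\<dots> = real l - 1 + 1 / (1 + 1 / (1 + 2 * \<delta>))"
      proof -
        have "1 / (1 + 1 / (1 + 2 * \<delta>)) = (1 + 2 * \<delta>) / (2 + 2 * \<delta>)"
          using \<delta> by (simp add: field_simps)
        then show ?thesis using \<delta> by (simp add: D_def add_divide_distrib[of "(real l - 1) * _"])
      qed
      finally have 2: "\<rho> < real l - 1 + 1 / (1 + 1 / (1 + 2 * \<delta>))" by (simp only: eq)
      show ?thesis using 1 2 by (simp add: \<beta>_def p0_def \<delta>_def[symmetric] max_def)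
    next
      case PInf
      then show ?thesis using l \<beta> by (simp add: \<rho>_def)
    next
      case MInf
      then show ?thesis using * by simp
    qed
    \<comment> \<open>Scaling all \<open>1 / p i\<close> by \<open>t\<close> turns the inequality with \<open>1 / r\<close> into the Hoelder relation.  If
      \<open>s = 0\<close>, all exponents are infinite and division by zero gives \<open>t = 0\<close>, as required.\<close>
    define t where "t = \<rho> / s"
    have t: "0 \<le> t" "t \<le> 1" using \<rho>(1) s by (auto simp: t_def divide_le_eq_1)
    define b where "b i = a i * t" for i
    have b: "0 \<le> b i \<and> b i \<le> a i" if "i < l" for i
      using a[OF that] t by (auto simp: b_def mult_left_le)
    have sum_b: "(\<Sum>i<l. b i) = \<rho>"
    proof -
      have "(\<Sum>i<l. b i) = s * t" by (simp only: b_def s_def sum_distrib_right)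
      then show ?thesis using \<rho>(1) s by (cases "s = 0") (auto simp: t_def)
    qed
    have "avg_bounded d k l b"
    proof (rule avg_bounded_below_critical[OF \<beta> l1])
      show "avg_bounded d k l c" if "j < l" "c j < \<beta>" "\<And>i. i < l \<Longrightarrow> 0 \<le> c i \<and> c i < 1" for c j
        using that by (rule base)
      show "0 \<le> b i \<and> b i < 1" if "i < l" for i using a[OF that] b[OF that] by simp
      show "(\<Sum>i<l. b i) < real l - 1 + \<beta>" using \<rho>_less by (simp only: sum_b)
    qed
    then show "T_max_bounded d k l p r"
    proof (rule T_max_bounded_if_avg_bounded[rotated 4])
      show "0 < p i" if "i < l" for i using * that order.strict_trans[of 0 1 "p i"] by simp
      show "0 < r" using * by blast
      show "0 \<le> b i \<and> b i \<le> real_of_ereal (1 / p i)" if "i < l" for i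
        using b[OF that] by (simp add: a_def)
      show "(\<Sum>i<l. b i) = real_of_ereal (1 / r)" using sum_b by (simp add: \<rho>_def)
    qed
  next
    fix p :: "nat \<Rightarrow> ereal" and r :: ereal
    assume *: "(\<forall>i<l. 1 < p i) \<and> 0 < r \<and> T_max_bounded d k l p r"
    show "r > ereal (real d / (real l * real d - real k))"
    proof (cases r)
      case (real r')
      have "r' > real d / (real l * real d - real k)"
      proof (rule T_max_bounded_imp_exponent_gt[OF k1 l1 dk])
        show "Cl > 0" using cl by simp
        show "0 < p i" if "i < l" for i using * that order.strict_trans[of 0 1 "p i"] by simp
        show "T_max_bounded d k l p (ereal r')" "r' > 0" using * real by auto
      qed (use Nl in blast)
      then show ?thesis using real by simp
    qed (use * in auto)
  qed
qed

end
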